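(* Let $d\ge 2$. The maximum number $M_d(n)$ of $d$-simplices of maximum $d$-volume formed by $n$ hyperplanes in $\mathbb{R}^d$ satisfies $$M_d(n)>\frac75\,(n-d)-O(1),$$ that is, there is an absolute constant $C$ such that $M_d(n)>\frac75(n-d)-C$ for all $d\ge 2$ and all $n\ge d+1$.
   Context: A set of $d+1$ hyperplanes in $\mathbb{R}^d$ forms a (non-degenerate) $d$-simplex if every $d$ of them meet in exactly one point and the $d+1$ hyperplanes have no common point; the $d$-simplex they form is the unique bounded cell of the arrangement of these $d+1$ hyperplanes (it may be cut by other hyperplanes of a larger arrangement). The $d$-simplices formed by a finite set $\mathcal{H}$ of distinct hyperplanes are the simplices formed by the $(d+1)$-element subsets of $\mathcal{H}$. The arrangement is not assumed to be in general position. The $d$-volume is the $d$-dimensional volume. A $d$-simplex formed by $\mathcal{H}$ has maximum $d$-volume if its $d$-volume is the largest among all $d$-simplices formed by $\mathcal{H}$. $M_d(n)$ is the maximum, over all sets $\mathcal{H}$ of $n$ distinct hyperplanes in $\mathbb{R}^d$, of the number of $d$-simplices of maximum $d$-volume formed by $\mathcal{H}$. *)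

theory Defs
  imports "HOL-Analysis.Analysis"
begin

text \<open>
  The constant in the theorem is uniform in the dimension, so the dimension has to be an ordinary
  natural number. Points of \<open>d\<close>-space are the functions \<open>nat \<Rightarrow> real\<close> that are \<open>undefined\<close> outside
  \<open>{..<d}\<close>. This set is both the topspace of \<open>powertop_real {..<d}\<close> and the space of the product
  measure \<open>\<Pi>\<^sub>M i\<in>{..<d}. lborel\<close>.
\<close>

definition rspace :: "nat \<Rightarrow> (nat \<Rightarrow> real) set" where
  "rspace d = (\<Pi>\<^sub>E i\<in>{..<d}. UNIV)"

definition volume :: "nat \<Rightarrow> (nat \<Rightarrow> real) set \<Rightarrow> real" where
  "volume d A = measure (\<Pi>\<^sub>M i\<in>{..<d}. lborel) A"

text \<open>
  The generic constant \<open>bounded\<close> must not be used here: it refers to the metric that the library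
  puts on \<open>nat \<Rightarrow> real\<close>, for which every set is bounded.
\<close>

definition coord_bounded :: "nat \<Rightarrow> (nat \<Rightarrow> real) set \<Rightarrow> bool" where
  "coord_bounded d A \<longleftrightarrow> (\<exists>B. \<forall>x\<in>A. \<forall>i<d. \<bar>x i\<bar> \<le> B)"

definition hyperplane :: "nat \<Rightarrow> (nat \<Rightarrow> real) set \<Rightarrow> bool" where
  "hyperplane d P \<longleftrightarrow>
     (\<exists>a b. (\<exists>i<d. a i \<noteq> 0) \<and> P = {x \<in> rspace d. (\<Sum>i<d. a i * x i) = b})"

definition cells :: "nat \<Rightarrow> (nat \<Rightarrow> real) set set \<Rightarrow> (nat \<Rightarrow> real) set set" where
  "cells d S = connected_components_of (subtopology (powertop_real {..<d}) (rspace d - \<Union>S))"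

definition forms_simplex :: "nat \<Rightarrow> (nat \<Rightarrow> real) set set \<Rightarrow> bool" where
  "forms_simplex d S \<longleftrightarrow>
     (\<forall>P\<in>S. hyperplane d P) \<and> card S = d + 1 \<and>
     (\<forall>T. T \<subseteq> S \<and> card T = d \<longrightarrow> (\<exists>!x. x \<in> \<Inter>T)) \<and> \<Inter>S = {}"

text \<open>Simplices are open cells; taking closures would not affect their volume or number.\<close>

definition simplex_of :: "nat \<Rightarrow> (nat \<Rightarrow> real) set set \<Rightarrow> (nat \<Rightarrow> real) set" where
  "simplex_of d S = (THE C. C \<in> cells d S \<and> coord_bounded d C)"

definition simplices :: "nat \<Rightarrow> (nat \<Rightarrow> real) set set \<Rightarrow> (nat \<Rightarrow> real) set set" where
  "simplices d H = {simplex_of d S | S. S \<subseteq> H \<and> forms_simplex d S}"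

definition max_volume_simplices :: "nat \<Rightarrow> (nat \<Rightarrow> real) set set \<Rightarrow> (nat \<Rightarrow> real) set set" where
  "max_volume_simplices d H =
     {\<Delta> \<in> simplices d H. \<forall>\<Delta>'\<in>simplices d H. volume d \<Delta>' \<le> volume d \<Delta>}"

text \<open>
  The set below is finite, as its members are at most \<open>n choose (d + 1)\<close>, and for \<open>d \<ge> 1\<close> it is
  nonempty, so \<open>Max\<close> is meaningful. The condition \<open>finite H\<close> only matters for \<open>n = 0\<close>, because
  infinite sets have \<open>card\<close> 0.
\<close>

definition max_count :: "nat \<Rightarrow> nat \<Rightarrow> nat" where
  "max_count d n =
     Max {card (max_volume_simplices d H) | H.
            finite H \<and> card H = n \<and> (\<forall>P\<in>H. hyperplane d P)}"

end

theory Submission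
  imports Defs
begin

text \<open>
  Everything reduces to the plane. Put \<open>w = 1 - (x 2 + \<dots> + x (d - 1))\<close> and replace a line
  \<open>a x + b y = c\<close> by the hyperplane \<open>a x 0 + b x 1 = c w\<close>: this is the cone over the line whose
  apexes are the unit points \<open>e 2, \<dots>, e (d - 1)\<close>. Add the \<open>d - 2\<close> hyperplanes \<open>x k = 0\<close>. If one of
  these is missing from \<open>d + 1\<close> hyperplanes of the arrangement, the corresponding apex is common to all
  of them; hence every simplex uses all of them together with the cones over three lines, it is the
  iterated cone over the triangle of these lines, and its volume is the area of the triangle times a
  constant. So \<open>m + 2\<close> lines in the plane with \<open>N\<close> triangles of maximum area give \<open>m + d\<close>
  hyperplanes with \<open>N\<close> simplices of maximum volume.

  In the plane, five sides of a regular pentagon form five triangles of maximum area, namely those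
  of sides \<open>i\<close>, \<open>i + 1\<close>, \<open>i + 3\<close>. Choose affine coordinates in which two sides that are neither
  equal nor adjacent are the coordinate axes; the other three sides then cross both axes on their
  positive halves. The maps \<open>(x, y) \<mapsto> (x / t, t y)\<close> preserve areas and fix the two axes, so the images of
  the pentagon under several such maps share the axes, and each image contributes five triangles
  for its three remaining lines. What has to be shown is that triangles with lines from different images
  do not exceed the common area. This makes \<open>5 (m div 3)\<close> triangles of maximum area from
  \<open>m + 2\<close> lines, and the slope \<open>5 / 3\<close> is larger than \<open>7 / 5\<close>.

  For the area inequality the lines are written as
  \<open>\<alpha>\<^sup>2 x + \<beta>\<^sup>2 y = \<kappa> \<alpha> \<beta>\<close>. By Cramer's rule twice the area of a triangle is the squared
  determinant of its three lines divided by the product of the absolute values of the three minors of the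
  normal vectors; with the axes, a line with \<open>\<kappa> = 1\<close> gives the value 1. As a function of the two
  ratios \<open>x\<close>, \<open>y\<close> of consecutive values of \<open>\<beta> / \<alpha>\<close>, this quotient is
  \<open>(det_form \<kappa>1 \<kappa>2 \<kappa>3 x y)\<^sup>2 / minor_form x y\<close>. The pentagon is affinely regular for \<open>\<kappa> \<in> {1, \<zeta>\<^sup>3}\<close> where
  \<open>\<zeta>\<^sup>4 + \<zeta>\<^sup>2 = 1\<close>, that is, \<open>\<zeta>\<^sup>2\<close> is the inverse of the golden ratio. The axes are the limits
  \<open>\<beta> / \<alpha> = 0\<close> and \<open>\<beta> / \<alpha> = \<infinity>\<close>, so the polynomial inequalities
  \<open>det_form\<^sup>2 \<le> minor_form\<close> settle the triangles with and without axes together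
  (lemma \<open>normalized_det_sq_le\<close>).

  That different triples of hyperplanes give different simplices, and that the bounded cell is
  the set of points with positive barycentric coordinates, is proved for arbitrary simplices in
  the locale \<open>barycentric\<close>.
\<close>

section \<open>Affine functions, convex sets and barycentric coordinates\<close>

definition affine_fun :: "nat \<Rightarrow> ((nat \<Rightarrow> real) \<Rightarrow> real) \<Rightarrow> bool" where
  "affine_fun d f \<longleftrightarrow> (\<exists>A c. \<forall>x. f x = (\<Sum>j<d. A j * x j) + c)"

definition combination :: "nat \<Rightarrow> 'i set \<Rightarrow> ('i \<Rightarrow> real) \<Rightarrow> ('i \<Rightarrow> nat \<Rightarrow> real) \<Rightarrow> nat \<Rightarrow> real" where
  "combination d I t V = (\<lambda>j\<in>{..<d}. \<Sum>k\<in>I. t k * V k j)"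

lemma combination_in_rspace: "combination d I t V \<in> rspace d"
  by (auto simp: combination_def rspace_def)

lemma affine_fun_combination:
  assumes "affine_fun d f" and "(\<Sum>k\<in>I. t k) = 1"
  shows "f (combination d I t V) = (\<Sum>k\<in>I. t k * f (V k))"
proof -
  obtain A c where f: "\<And>x. f x = (\<Sum>j<d. A j * x j) + c"
    using assms(1) by (auto simp: affine_fun_def)
  have "(\<Sum>k\<in>I. t k * f (V k)) = (\<Sum>k\<in>I. \<Sum>j<d. A j * (t k * V k j)) + (\<Sum>k\<in>I. t k) * c"
    by (simp add: f algebra_simps sum.distrib sum_distrib_left sum_distrib_right)
  also have "(\<Sum>k\<in>I. \<Sum>j<d. A j * (t k * V k j)) = (\<Sum>j<d. A j * (\<Sum>k\<in>I. t k * V k j))"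
    by (subst sum.swap) (simp add: sum_distrib_left)
  also have "\<dots> = (\<Sum>j<d. A j * combination d I t V j)"
    by (simp add: combination_def)
  finally show ?thesis
    using assms(2) by (simp add: f)
qed

lemma affine_fun_continuous:
  assumes "affine_fun d f"
  shows "continuous_map (powertop_real {..<d}) euclideanreal f"
proof -
  obtain A c where f: "f = (\<lambda>x. (\<Sum>j<d. A j * x j) + c)"
    using assms by (auto simp: affine_fun_def fun_eq_iff)
  show ?thesis
    unfolding f
    by (intro continuous_intros continuous_map_product_projection) auto
qed

lemma hyperplane_affine_fun:
  assumes "affine_fun d f" and "x \<in> rspace d" and "y \<in> rspace d" and "f x \<noteq> f y"
  shows "hyperplane d {x \<in> rspace d. f x = 0}"
proof -
  obtain A c where f: "\<And>x. f x = (\<Sum>j<d. A j * x j) + c"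
    using assms(1) by (auto simp: affine_fun_def)
  have "\<exists>i<d. A i \<noteq> 0"
  proof (rule ccontr)
    assume "\<not> ?thesis"
    then have "(\<Sum>j<d. A j * x j) = 0" "(\<Sum>j<d. A j * y j) = 0"
      by (simp_all add: sum.neutral)
    then show False using assms(4) by (simp add: f)
  qed
  moreover have "{x \<in> rspace d. f x = 0} = {x \<in> rspace d. (\<Sum>j<d. A j * x j) = - c}"
    by (auto simp: f)
  ultimately show ?thesis
    unfolding hyperplane_def by blast
qed

text \<open>
  Points of \<open>rspace d\<close> are \<open>undefined\<close> outside \<open>{..<d}\<close>, so \<open>rspace d\<close> is not closed under the pointwise
  vector space operations and the notion \<open>convex\<close> of the library does not apply; segments are
  formed on \<open>{..<d}\<close> only.
\<close>

lemma connectedin_convex: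
  assumes "S \<subseteq> rspace d"
    and "\<And>x y t. x \<in> S \<Longrightarrow> y \<in> S \<Longrightarrow> 0 \<le> t \<Longrightarrow> t \<le> 1 \<Longrightarrow>
           (\<lambda>j\<in>{..<d}. (1 - t) * x j + t * y j) \<in> S"
  shows "connectedin (powertop_real {..<d}) S"
proof -
  let ?X = "powertop_real {..<d}"
  have "\<exists>T. connectedin ?X T \<and> x \<in> T \<and> y \<in> T \<and> T \<subseteq> S" if "x \<in> S" "y \<in> S" for x y
  proof -
    define \<gamma> where "\<gamma> = (\<lambda>t. \<lambda>j\<in>{..<d}. (1 - t) * x j + t * y j)"
    have "continuous_map (top_of_set {0..1}) ?X \<gamma>"
      unfolding continuous_map_componentwise \<gamma>_def
      by (auto simp: continuous_map_iff_continuous intro!: continuous_intros)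
    moreover have "connectedin (top_of_set {0..1}) {0..1::real}"
      by (simp add: connectedin_subtopology)
    ultimately have "connectedin ?X (\<gamma> ` {0..1})"
      by (rule connectedin_continuous_map_image)
    moreover have "\<gamma> 0 = x" "\<gamma> 1 = y"
      using that assms(1) by (auto simp: \<gamma>_def rspace_def PiE_def extensional_def fun_eq_iff)
    then have "x \<in> \<gamma> ` {0..1}" "y \<in> \<gamma> ` {0..1}" 
      by (metis atLeastAtMost_iff imageI order.refl zero_le_one)+
    moreover have "\<gamma> ` {0..1} \<subseteq> S"
      using that assms(2) by (auto simp: \<gamma>_def)
    ultimately show ?thesis by blast
  qed
  then have ex: "\<exists>T. connectedin (subtopology ?X S) T \<and> x \<in> T \<and> y \<in> T" if "x \<in> S" "y \<in> S" for x y
    using that unfolding connectedin_subtopology by blast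
  have top: "S \<subseteq> topspace ?X"
    using assms(1) by (simp add: rspace_def)
  then have "topspace (subtopology ?X S) = S"
    by (simp add: inf_absorb2)
  then have "connected_space (subtopology ?X S)"
    unfolding connected_space_subconnected using ex by simp
  then show ?thesis
    using top by (simp add: connectedin_def)
qed

text \<open>
  The functions \<open>g i\<close> are the barycentric coordinates with respect to the vertices \<open>V i\<close>. The zero set
  of \<open>g i\<close> is the hyperplane opposite to \<open>V i\<close>.
\<close>

locale barycentric =
  fixes d :: nat and I :: "'i set" and g :: "'i \<Rightarrow> (nat \<Rightarrow> real) \<Rightarrow> real"
    and V :: "'i \<Rightarrow> nat \<Rightarrow> real"
  assumes dim_pos: "1 \<le> d"
    and fin: "finite I" and card_I: "card I = d + 1"
    and aff: "i \<in> I \<Longrightarrow> affine_fun d (g i)"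
    and vertex: "i \<in> I \<Longrightarrow> V i \<in> rspace d"
    and dual: "i \<in> I \<Longrightarrow> k \<in> I \<Longrightarrow> g i (V k) = (if i = k then 1 else 0)"
    and coord_eq: "x \<in> rspace d \<Longrightarrow> j < d \<Longrightarrow> x j = (\<Sum>k\<in>I. g k x * V k j)"
    and sum_eq_1: "x \<in> rspace d \<Longrightarrow> (\<Sum>k\<in>I. g k x) = 1"
begin

definition facet :: "'i \<Rightarrow> (nat \<Rightarrow> real) set" where
  "facet i = {x \<in> rspace d. g i x = 0}"

definition open_simplex :: "(nat \<Rightarrow> real) set" where
  "open_simplex = {x \<in> rspace d. \<forall>i\<in>I. g i x > 0}"

lemma g_combination:
  assumes "(\<Sum>k\<in>I. t k) = 1" and "i \<in> I"
  shows "g i (combination d I t V) = t i"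
proof -
  have "g i (combination d I t V) = (\<Sum>k\<in>I. t k * g i (V k))"
    by (rule affine_fun_combination[OF aff[OF assms(2)] assms(1)])
  also have "\<dots> = (\<Sum>k\<in>I. if i = k then t k else 0)"
    using assms(2) dual by (intro sum.cong) auto
  also have "\<dots> = t i"
    using assms(2) fin by simp
  finally show ?thesis .
qed

lemma combination_g:
  assumes "x \<in> rspace d"
  shows "combination d I (\<lambda>k. g k x) V = x"
  using assms coord_eq[OF assms]
  by (auto simp: combination_def rspace_def PiE_def extensional_def fun_eq_iff)

lemma eqI:
  assumes "x \<in> rspace d" "y \<in> rspace d" "\<And>i. i \<in> I \<Longrightarrow> g i x = g i y"
  shows "x = y"
proof -
  have "combination d I (\<lambda>k. g k x) V = combination d I (\<lambda>k. g k y) V"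
    using assms(3) unfolding combination_def by (intro restrict_ext sum.cong) auto
  then show ?thesis
    using combination_g assms by simp
qed

lemma g_segment:
  assumes "i \<in> I" and "x \<in> rspace d" and "y \<in> rspace d"
  shows "g i (\<lambda>j\<in>{..<d}. (1 - t) * x j + t * y j) = (1 - t) * g i x + t * g i y"
proof -
  have "(\<lambda>j\<in>{..<d}. (1 - t) * x j + t * y j) =
      combination d {False, True} (\<lambda>b. if b then t else 1 - t) (\<lambda>b. if b then y else x)"
    by (auto simp: combination_def)
  then show ?thesis
    using affine_fun_combination[OF aff[OF assms(1)],
        where I = "{False, True}" and t = "\<lambda>b. if b then t else 1 - t"
          and V = "\<lambda>b. if b then y else x"]
    by simp
qed

lemma other_index: 
  assumes "i \<in> I" obtains k where "k \<in> I" "k \<noteq> i"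
proof -
  have "card (I - {i}) = d" using assms card_I fin by simp
  then have "I - {i} \<noteq> {}" using dim_pos by (metis card.empty not_one_le_zero)
  then show ?thesis using that by blast
qed

lemma inj_facet: "inj_on facet I"
proof (rule inj_onI)
  fix i k assume "i \<in> I" "k \<in> I" "facet i = facet k"
  then have "V k \<in> facet i \<longleftrightarrow> V k \<in> facet k" by simp
  then show "i = k"
    using \<open>i \<in> I\<close> \<open>k \<in> I\<close> by (auto simp: facet_def dual vertex split: if_splits)
qed

lemma forms_simplex_facets: "forms_simplex d (facet ` I)"
  unfolding forms_simplex_def
proof (intro conjI ballI allI impI)
  fix P assume "P \<in> facet ` I"
  then obtain i where i: "i \<in> I" "P = facet i" by blast
  obtain k where "k \<in> I" "k \<noteq> i" using other_index i by blast
  then show "hyperplane d P"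
    unfolding i(2) facet_def using i(1)
    by (intro hyperplane_affine_fun[of d "g i" "V i" "V k"]) (auto simp: aff vertex dual)
next
  show "card (facet ` I) = d + 1"
    using card_image[OF inj_facet] card_I by simp
next
  fix T assume T: "T \<subseteq> facet ` I \<and> card T = d"
  then obtain J where J: "J \<subseteq> I" "T = facet ` J"
    by (meson subset_imageE)
  have cJ: "card J = d" 
    using T J card_image[OF inj_on_subset[OF inj_facet J(1)]] by simp
  have "card (I - J) = 1"
    using cJ J(1) card_I fin by (simp add: card_Diff_subset finite_subset)
  then obtain k where k: "I - J = {k}"
    by (meson card_1_singletonE)
  then have JI: "J = I - {k}" "k \<in> I" using J(1) by auto
  have Jne: "J \<noteq> {}" using cJ dim_pos by auto
  show "\<exists>!x. x \<in> \<Inter>T"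
  proof
    show "V k \<in> \<Inter>T"
      using JI by (auto simp: J(2) facet_def vertex dual)
  next
    fix x assume x: "x \<in> \<Inter>T"
    have xr: "x \<in> rspace d" using x Jne by (auto simp: J(2) facet_def)
    have z: "g i x = 0" if "i \<in> I" "i \<noteq> k" for i
      using x that JI by (auto simp: J(2) facet_def)
    have "(\<Sum>i\<in>I. g i x) = g k x"
      using z JI(2) fin by (subst sum.remove[of I k]) auto
    then have "g k x = 1" using sum_eq_1[OF xr] by simp
    then show "x = V k"
      using z xr JI(2) by (intro eqI) (auto simp: vertex dual)
  qed
next
  have "x \<notin> \<Inter>(facet ` I)" for x
  proof
    assume x: "x \<in> \<Inter>(facet ` I)"
    obtain i where "i \<in> I" using card_I by fastforce
    then have "x \<in> rspace d" using x by (auto simp: facet_def)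
    moreover have "(\<Sum>i\<in>I. g i x) = 0"
      using x by (intro sum.neutral) (auto simp: facet_def)
    ultimately show False using sum_eq_1 by simp
  qed
  then show "\<Inter>(facet ` I) = {}" by blast
qed

definition region :: "(nat \<Rightarrow> real) \<Rightarrow> (nat \<Rightarrow> real) set" where
  "region x = {y \<in> rspace d. \<forall>i\<in>I. sgn (g i y) = sgn (g i x)}"

text \<open>
  A connected set that avoids all facets cannot change the sign of any \<open>g i\<close>, and the points with given
  signs form a convex set. So the cells are the nonempty sign regions.
\<close>

lemma cell_eq_region:
  assumes "x \<in> rspace d - \<Union>(facet ` I)"
  shows "connected_component_of_set
           (subtopology (powertop_real {..<d}) (rspace d - \<Union>(facet ` I))) x = region x"
    (is "connected_component_of_set ?X x = _")
proof -
  have nz: "g i x \<noteq> 0" if "i \<in> I" for i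
    using assms that by (auto simp: facet_def)
  have xr: "x \<in> rspace d" using assms by auto
  have sub: "region x \<subseteq> rspace d - \<Union>(facet ` I)"
    using nz by (force simp: region_def facet_def sgn_zero_iff)
  have "connectedin (powertop_real {..<d}) (region x)"
  proof (rule connectedin_convex)
    fix y z t assume yz: "y \<in> region x" "z \<in> region x" and t: "0 \<le> t" "t \<le> (1::real)"
    show "(\<lambda>j\<in>{..<d}. (1 - t) * y j + t * z j) \<in> region x"
      unfolding region_def
    proof (intro CollectI conjI ballI)
      show "(\<lambda>j\<in>{..<d}. (1 - t) * y j + t * z j) \<in> rspace d"
        by (auto simp: rspace_def)
      fix i assume i: "i \<in> I"
      have s: "sgn (g i y) = sgn (g i x)" "sgn (g i z) = sgn (g i x)"
        using yz i by (auto simp: region_def)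
      have "sgn ((1 - t) * g i y + t * g i z) = sgn (g i x)"
      proof (cases "g i x > 0")
        case True
        then have "g i y > 0" "g i z > 0" using s by (auto simp: sgn_1_pos)
        then have "(1 - t) * g i y + t * g i z > 0"
          using t by (cases "t = 0") (auto intro: add_nonneg_pos)
        then show ?thesis using True by simp
      next
        case False
        then have "g i x < 0" using nz[OF i] by simp
        then have "g i y < 0" "g i z < 0" using s by (auto simp: sgn_1_neg)
        then have "(1 - t) * g i y + t * g i z < 0"
          using t by (cases "t = 0") (auto intro!: add_nonpos_neg simp: mult_nonneg_nonpos mult_pos_neg)
        then show ?thesis using \<open>g i x < 0\<close> by simp
      qed
      moreover have "y \<in> rspace d" "z \<in> rspace d" using yz by (auto simp: region_def)
      ultimately show "sgn (g i (\<lambda>j\<in>{..<d}. (1 - t) * y j + t * z j)) = sgn (g i x)"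
        using g_segment[OF i] by simp
    qed
  qed (auto simp: region_def)
  then have "connectedin ?X (region x)"
    using sub by (simp add: connectedin_subtopology)
  moreover have "x \<in> region x" using xr by (simp add: region_def)
  ultimately have "region x \<subseteq> connected_component_of_set ?X x"
    by (rule connected_component_of_maximal)
  moreover have "y \<in> region x" if y: "connected_component_of ?X x y" for y
  proof -
    obtain T where T: "connectedin ?X T" "x \<in> T" "y \<in> T"
      using y by (auto simp: connected_component_of_def)
    have Ts: "T \<subseteq> rspace d - \<Union>(facet ` I)"
      using T(1) by (auto simp: connectedin_subtopology)
    have "sgn (g i y) = sgn (g i x)" if i: "i \<in> I" for i
    proof -
      have "continuous_map ?X euclideanreal (g i)"
        by (intro continuous_map_from_subtopology affine_fun_continuous aff i)
      then have con: "connected (g i ` T)"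
        using connectedin_continuous_map_image T(1) connectedin_iff_connected by blast
      have "0 \<notin> g i ` T" using Ts i by (force simp: facet_def)
      then have "\<not> (g i x < 0 \<and> 0 < g i y)" "\<not> (g i y < 0 \<and> 0 < g i x)" 
        "g i x \<noteq> 0" "g i y \<noteq> 0"
        using connectedD_interval[OF con] T(2,3) by (meson imageI less_imp_le, meson imageI less_imp_le, force+)
      then show ?thesis by (auto simp: sgn_if)
    qed
    then show ?thesis using Ts T(3) by (auto simp: region_def)
  qed
  ultimately show ?thesis by auto
qed

text \<open>The barycenter is a witness.\<close>

lemma simplex_nonempty: "open_simplex \<noteq> {}"
proof -
  define t where "t = (\<lambda>k::'i. 1 / real (d + 1))"
  have "(\<Sum>k\<in>I. t k) = 1" using card_I by (simp add: t_def)
  then have "g i (combination d I t V) > 0" if "i \<in> I" for i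
    using that by (simp add: g_combination) (simp add: t_def)
  then have "combination d I t V \<in> open_simplex"
    by (simp add: open_simplex_def combination_in_rspace)
  then show ?thesis by blast
qed

lemma simplex_bounded: "coord_bounded d open_simplex"
proof -
  have "\<bar>x j\<bar> \<le> (\<Sum>j<d. \<Sum>k\<in>I. \<bar>V k j\<bar>)" if x: "x \<in> open_simplex" and j: "j < d" for x j
  proof -
    have xr: "x \<in> rspace d" and pos: "\<And>k. k \<in> I \<Longrightarrow> 0 < g k x" using x by (auto simp: open_simplex_def)
    have le1: "g k x \<le> 1" if "k \<in> I" for k
      using sum_eq_1[OF xr] member_le_sum[OF that, of "\<lambda>k. g k x"] fin pos by (force simp: less_imp_le)
    have "\<bar>x j\<bar> \<le> (\<Sum>k\<in>I. \<bar>g k x * V k j\<bar>)"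
      using coord_eq[OF xr j] by (simp add: sum_abs)
    also have "\<dots> \<le> (\<Sum>k\<in>I. \<bar>V k j\<bar>)"
      using pos le1 by (intro sum_mono) (simp add: abs_mult mult_left_le_one_le less_imp_le)
    also have "\<dots> \<le> (\<Sum>j<d. \<Sum>k\<in>I. \<bar>V k j\<bar>)"
      using j by (intro member_le_sum) (auto intro: sum_nonneg)
    finally show ?thesis .
  qed
  then show ?thesis unfolding coord_bounded_def by blast
qed

text \<open>
  The coordinates sum to 1, so beside the negative one there is a positive one. Shifting weight
  from the former to the latter preserves all signs and can go on forever.
\<close>

lemma region_unbounded:
  assumes x: "x \<in> rspace d" and neg: "i \<in> I" "g i x < 0"
  shows "\<not> coord_bounded d (region x)"
proof
  assume "coord_bounded d (region x)"
  then obtain B where B: "\<And>y j. y \<in> region x \<Longrightarrow> j < d \<Longrightarrow> \<bar>y j\<bar> \<le> B"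
    unfolding coord_bounded_def by blast
  have "\<exists>k\<in>I. g k x > 0"
  proof (rule ccontr)
    assume "\<not> ?thesis"
    then have "(\<Sum>k\<in>I. g k x) \<le> 0" by (intro sum_nonpos) (auto simp: not_less)
    then show False using sum_eq_1[OF x] by simp
  qed
  then obtain k where k: "k \<in> I" "g k x > 0" by blast
  then have ik: "i \<noteq> k" using neg by auto
  define y where "y s = combination d I (\<lambda>l. g l x + (if l = k then s else if l = i then - s else 0)) V" for s
  have sum: "(\<Sum>l\<in>I. g l x + (if l = k then s else if l = i then - s else 0)) = 1" for s
  proof -
    have "(\<Sum>l\<in>I. if l = k then s else if l = i then - s else 0) =
       (\<Sum>l\<in>I. (if l = k then s else 0) + (if l = i then - s else 0))"
      using ik by (intro sum.cong) auto
    also have "\<dots> = 0" using k(1) neg(1) fin by (simp add: sum.distrib)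
    finally show ?thesis using sum_eq_1[OF x] by (simp add: sum.distrib)
  qed
  have gy: "g l (y s) = g l x + (if l = k then s else if l = i then - s else 0)" if "l \<in> I" for l s
    unfolding y_def by (rule g_combination[OF sum that])
  have yreg: "y s \<in> region x" if "s \<ge> 0" for s
  proof -
    have "y s \<in> rspace d" by (simp add: y_def combination_in_rspace)
    then show ?thesis using that k neg by (auto simp: region_def gy)
  qed
  obtain A c where A: "\<And>x. g k x = (\<Sum>j<d. A j * x j) + c"
    using aff[OF k(1)] by (auto simp: affine_fun_def)
  have bound: "g k (y s) \<le> (\<Sum>j<d. \<bar>A j\<bar> * B) + c" if "s \<ge> 0" for s
  proof -
    have "(\<Sum>j<d. A j * y s j) \<le> (\<Sum>j<d. \<bar>A j\<bar> * B)"
    proof (rule sum_mono)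
      fix j assume "j \<in> {..<d}"
      then have "\<bar>y s j\<bar> \<le> B" using B yreg that by auto
      then have "\<bar>A j * y s j\<bar> \<le> \<bar>A j\<bar> * B" by (simp add: abs_mult mult_left_mono)
      then show "A j * y s j \<le> \<bar>A j\<bar> * B" by linarith
    qed
    then show ?thesis by (simp add: A)
  qed
  define s where "s = max 0 ((\<Sum>j<d. \<bar>A j\<bar> * B) + c)"
  have "g k (y s) = g k x + s" using gy k(1) by simp
  then show False using bound[of s] k(2) by (auto simp: s_def max_def split: if_splits)
qed

lemma region_of_simplex:
  assumes "x \<in> open_simplex" shows "region x = open_simplex"
  using assms by (auto simp: region_def open_simplex_def sgn_1_pos[symmetric])

lemma simplex_of_facets: "simplex_of d (facet ` I) = open_simplex"
  unfolding simplex_of_def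
proof (rule the_equality)
  obtain x where x: "x \<in> open_simplex" using simplex_nonempty by blast
  have xin: "x \<in> rspace d - \<Union>(facet ` I)" using x by (force simp: open_simplex_def facet_def)
  have "open_simplex \<in> cells d (facet ` I)"
    unfolding cells_def connected_components_of_def
    using cell_eq_region[OF xin] region_of_simplex[OF x] xin
    by (auto simp: image_iff rspace_def intro!: bexI[of _ x])
  then show "open_simplex \<in> cells d (facet ` I) \<and> coord_bounded d open_simplex"
    using simplex_bounded by blast
next
  fix C assume C: "C \<in> cells d (facet ` I) \<and> coord_bounded d C"
  then obtain x where x: "x \<in> rspace d - \<Union>(facet ` I)" and Cx: "C = region x"
    unfolding cells_def connected_components_of_def
    using cell_eq_region by (auto simp: rspace_def)
  have "g i x > 0" if "i \<in> I" for i
    using region_unbounded[of x i] C Cx x that by (force simp: facet_def)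
  then have "x \<in> open_simplex" using x by (auto simp: open_simplex_def)
  then show "C = open_simplex" using region_of_simplex Cx by simp
qed

end

text \<open>
  The barycenter \<open>x\<close> of the facet opposite to \<open>V i\<close> lies outside the open simplex, so \<open>g' j x \<le> 0\<close> for some
  \<open>j\<close>. But \<open>g' j\<close> is nonnegative at all vertices, and its value at \<open>x\<close> is the average of its values at
  the vertices other than \<open>V i\<close>. Hence it vanishes at these and is a multiple of \<open>g i\<close>.
\<close>

lemma facets_subset_if_simplex_eq:
  assumes B: "barycentric d I g V" and B': "barycentric d I' g' V'"
    and eq: "barycentric.open_simplex d I g = barycentric.open_simplex d I' g'"
  shows "barycentric.facet d g ` I \<subseteq> barycentric.facet d g' ` I'"
proof
  interpret b: barycentric d I g V by fact
  interpret b': barycentric d I' g' V' by fact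
  fix P assume "P \<in> b.facet ` I"
  then obtain i where i: "i \<in> I" and P: "P = b.facet i" by blast
  have nonneg: "0 \<le> g' j (V k)" if j: "j \<in> I'" and k: "k \<in> I" for j k
  proof (rule ccontr)
    assume neg: "\<not> 0 \<le> g' j (V k)"
    obtain c where c: "c \<in> b.open_simplex" using b.simplex_nonempty by blast
    have cr: "c \<in> rspace d" using c by (simp add: b.open_simplex_def)
    have gc: "0 < g' j c" using c j eq by (simp add: b'.open_simplex_def)
    \<comment> \<open>On the segment from \<open>V k\<close> to the interior point \<open>c\<close>, the function \<open>g' j\<close> vanishes at parameter \<open>t\<close>.\<close>
    define t where "t = - g' j (V k) / (g' j c - g' j (V k))"
    have t: "0 < t" "t < 1" using neg gc by (auto simp: t_def field_simps)
    define p where "p = (\<lambda>j\<in>{..<d}. (1 - t) * V k j + t * c j)"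
    have "p \<in> b.open_simplex"
      unfolding b.open_simplex_def
    proof (intro CollectI conjI ballI)
      show "p \<in> rspace d" by (auto simp: p_def rspace_def)
      fix l assume l: "l \<in> I"
      have "0 < g l c" using c l by (simp add: b.open_simplex_def)
      then show "0 < g l p"
        using t l k by (auto simp: p_def b.g_segment b.vertex cr b.dual intro: add_pos_pos)
    qed
    then have "0 < g' j p" using eq j by (simp add: b'.open_simplex_def)
    moreover have "g' j p = (1 - t) * g' j (V k) + t * g' j c"
      unfolding p_def using j k by (intro b'.g_segment) (auto simp: b.vertex cr)
    moreover have "\<dots> = 0"
      using neg gc by (simp add: t_def field_simps)
    ultimately show False by simp
  qed
  define t where "t k = (if k = i then 0 else 1 / real d)" for k
  have st: "(\<Sum>k\<in>I. t k) = 1"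
    using i b.fin b.card_I b.dim_pos by (subst sum.remove[of I i]) (auto simp: t_def)
  define x where "x = combination d I t V"
  have xr: "x \<in> rspace d" by (simp add: x_def combination_in_rspace)
  have gx: "g k x = t k" if "k \<in> I" for k unfolding x_def by (rule b.g_combination[OF st that])
  have "x \<notin> b.open_simplex" using gx[OF i] i by (force simp: b.open_simplex_def t_def)
  then obtain j where j: "j \<in> I'" "g' j x \<le> 0"
    using xr eq by (force simp: b'.open_simplex_def not_less)
  have g'j: "g' j y = (\<Sum>k\<in>I. g k y * g' j (V k))" if "y \<in> rspace d" for y
    using affine_fun_combination[OF b'.aff[OF j(1)] b.sum_eq_1[OF that], of V]
      b.combination_g[OF that] by simp
  have "(\<Sum>k\<in>I. t k * g' j (V k)) \<le> 0" using j(2) g'j[OF xr] gx by simp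
  moreover have nn: "0 \<le> t k * g' j (V k)" if "k \<in> I" for k
    using nonneg[OF j(1) that] by (simp add: t_def)
  ultimately have "t k * g' j (V k) = 0" if "k \<in> I" for k
    using sum_nonneg_eq_0_iff[OF b.fin, of "\<lambda>k. t k * g' j (V k)"] that
      sum_nonneg[of I "\<lambda>k. t k * g' j (V k)"] by fastforce
  then have zero: "g' j (V k) = 0" if "k \<in> I" "k \<noteq> i" for k
    using that b.dim_pos by (force simp: t_def)
  have scaled: "g' j y = g i y * g' j (V i)" if "y \<in> rspace d" for y
    unfolding g'j[OF that] using i b.fin zero by (subst sum.remove[of I i]) auto
  have "g' j (V' j) = 1" using b'.dual j(1) by simp
  then have "g' j (V i) \<noteq> 0" using scaled[OF b'.vertex[OF j(1)]] by auto
  then have "b'.facet j = b.facet i"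
    using scaled by (auto simp: b'.facet_def b.facet_def)
  then show "P \<in> b'.facet ` I'" using P j(1) by blast
qed

lemma facets_eq_if_simplex_eq:
  assumes "barycentric d I g V" and "barycentric d I' g' V'"
    and "barycentric.open_simplex d I g = barycentric.open_simplex d I' g'"
  shows "barycentric.facet d g ` I = barycentric.facet d g' ` I'"
  using facets_subset_if_simplex_eq[OF assms]
    facets_subset_if_simplex_eq[OF assms(2,1) assms(3)[symmetric]] by blast

section \<open>Volume under affine substitutions\<close>

interpretation lborel_product: product_sigma_finite "\<lambda>_::nat. lborel :: real measure"
  by standard

abbreviation lebesgue_pi :: "nat \<Rightarrow> (nat \<Rightarrow> real) measure" where
  "lebesgue_pi d \<equiv> \<Pi>\<^sub>M i\<in>{..<d}. lborel"

text \<open>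
  Fubini with coordinate \<open>i\<close> innermost: for fixed other coordinates this is a one-dimensional affine
  substitution.
\<close>

lemma emeasure_affine_update:
  fixes \<alpha> :: real
  assumes i: "i < d" and \<alpha>: "\<alpha> \<noteq> 0" and B: "B \<in> sets (lebesgue_pi d)"
    and h [measurable]: "h \<in> borel_measurable (lebesgue_pi d)"
    and indep: "\<And>x t. h (x(i := t)) = h x"
  shows "emeasure (lebesgue_pi d) {x \<in> space (lebesgue_pi d). x(i := \<alpha> * x i + h x) \<in> B} =
         ennreal (1 / \<bar>\<alpha>\<bar>) * emeasure (lebesgue_pi d) B" (is "emeasure ?M ?A = _")
proof -
  define J where "J = {..<d} - {i}"
  have J: "finite J" "i \<notin> J" "insert i J = {..<d}" using i by (auto simp: J_def)
  have upd [measurable]: "(\<lambda>x. x(i := \<alpha> * x i + h x)) \<in> measurable ?M ?M"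
    using i by (intro measurable_fun_upd[where J="{..<d}"]) auto
  note B [measurable]
  have A: "?A \<in> sets ?M" by measurable
  have "emeasure ?M ?A = (\<integral>\<^sup>+x. indicator ?A x \<partial>?M)" using A by simp
  also have "\<dots> = (\<integral>\<^sup>+x. indicator B (x(i := \<alpha> * x i + h x)) \<partial>?M)"
    by (intro nn_integral_cong) (auto simp: indicator_def)
  also have "\<dots> = (\<integral>\<^sup>+x. (\<integral>\<^sup>+y. indicator B (x(i := \<alpha> * y + h x)) \<partial>lborel) \<partial>(\<Pi>\<^sub>M i\<in>J. lborel))"
    by (subst J(3)[symmetric], subst lborel_product.product_nn_integral_insert[OF J(1,2)])
       (use J(3) in \<open>auto simp: indep\<close>)
  also have "\<dots> = (\<integral>\<^sup>+x. ennreal (1 / \<bar>\<alpha>\<bar>) * (\<integral>\<^sup>+y. indicator B (x(i := y)) \<partial>lborel) \<partial>(\<Pi>\<^sub>M i\<in>J. lborel))"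
  proof (rule nn_integral_cong)
    fix x assume x: "x \<in> space (\<Pi>\<^sub>M i\<in>J. (lborel :: real measure))"
    have meas: "(\<lambda>y. indicator B (x(i := y)) :: ennreal) \<in> borel_measurable borel"
    proof -
      have "(\<lambda>y. x(i := y)) \<in> measurable borel (\<Pi>\<^sub>M i\<in>insert i J. lborel)"
        using x J(2) by (intro measurable_fun_upd[where J=J]) auto
      then have "(\<lambda>y. x(i := y)) \<in> measurable borel ?M" by (simp add: J(3))
      then show ?thesis by measurable
    qed
    show "(\<integral>\<^sup>+y. indicator B (x(i := \<alpha> * y + h x)) \<partial>lborel) =
        ennreal (1 / \<bar>\<alpha>\<bar>) * (\<integral>\<^sup>+y. indicator B (x(i := y)) \<partial>lborel)"
      unfolding nn_integral_real_affine[OF meas \<alpha>, of "h x"] mult.assoc[symmetric]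
      using \<alpha> by (simp add: add.commute flip: ennreal_mult)
  qed
  also have "\<dots> = ennreal (1 / \<bar>\<alpha>\<bar>) * (\<integral>\<^sup>+x. (\<integral>\<^sup>+y. indicator B (x(i := y)) \<partial>lborel) \<partial>(\<Pi>\<^sub>M i\<in>J. lborel))"
  proof (rule nn_integral_cmult)
    have "(\<lambda>w. (fst w)(i := snd w)) \<in> measurable ((\<Pi>\<^sub>M i\<in>J. lborel) \<Otimes>\<^sub>M lborel) (\<Pi>\<^sub>M i\<in>insert i J. (lborel::real measure))"
      by (intro measurable_fun_upd[where J=J]) auto
    then have [measurable]: "(\<lambda>w. (fst w)(i := snd w)) \<in> measurable ((\<Pi>\<^sub>M i\<in>J. lborel) \<Otimes>\<^sub>M lborel) ?M"
      by (simp add: J(3))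
    have "(\<lambda>w. indicator B ((fst w)(i := snd w)) :: ennreal) \<in> borel_measurable ((\<Pi>\<^sub>M i\<in>J. lborel) \<Otimes>\<^sub>M lborel)"
      by measurable
    then have [measurable]: "case_prod (\<lambda>x y. indicator B (x(i := y)) :: ennreal) \<in> borel_measurable ((\<Pi>\<^sub>M i\<in>J. lborel) \<Otimes>\<^sub>M lborel)"
      by (simp add: case_prod_unfold)
    show "(\<lambda>x. \<integral>\<^sup>+y. indicator B (x(i := y)) \<partial>lborel) \<in> borel_measurable (\<Pi>\<^sub>M i\<in>J. lborel)"
      by measurable
  qed
  also have "(\<integral>\<^sup>+x. (\<integral>\<^sup>+y. indicator B (x(i := y)) \<partial>lborel) \<partial>(\<Pi>\<^sub>M i\<in>J. lborel)) = (\<integral>\<^sup>+x. indicator B x \<partial>?M)"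
    by (subst J(3)[symmetric], subst lborel_product.product_nn_integral_insert[OF J(1,2)])
       (use J(3) in auto)
  also have "\<dots> = emeasure ?M B" using B by simp
  finally show ?thesis .
qed

text \<open>
  Gaussian elimination with pivot \<open>a\<close> writes the map as two substitutions that change one coordinate
  each. The second one is expressed in the new value of coordinate 0; its factor \<open>\<beta>\<close> is the Schur complement.
\<close>

lemma emeasure_planar_substitution:
  fixes a b a' b' :: real
  assumes d: "2 \<le> d" and B: "B \<in> sets (lebesgue_pi d)"
    and h [measurable]: "h \<in> borel_measurable (lebesgue_pi d)"
    and h' [measurable]: "h' \<in> borel_measurable (lebesgue_pi d)"
    and indep: "\<And>x s t. h (x(0 := s, 1 := t)) = h x" "\<And>x s t. h' (x(0 := s, 1 := t)) = h' x"
    and a: "a \<noteq> 0" and det: "a * b' - a' * b \<noteq> 0"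
  shows "emeasure (lebesgue_pi d) {x \<in> space (lebesgue_pi d).
             x(0 := a * x 0 + b * x 1 + h x, 1 := a' * x 0 + b' * x 1 + h' x) \<in> B} =
         ennreal (1 / \<bar>a * b' - a' * b\<bar>) * emeasure (lebesgue_pi d) B"
proof -
  let ?M = "lebesgue_pi d"
  have ind: "h (x(0 := s)) = h x" "h (x(1 := s)) = h x" "h' (x(0 := s)) = h' x" "h' (x(1 := s)) = h' x" for x s
    using indep(1)[of x s "x 1"] indep(1)[of x "x 0" s] indep(2)[of x s "x 1"] indep(2)[of x "x 0" s]
    by (simp_all add: fun_upd_idem fun_upd_twist)
  define \<beta> where "\<beta> = b' - a' * b / a"
  have \<beta>: "\<beta> \<noteq> 0" "a * \<beta> = a * b' - a' * b" using a det by (auto simp: \<beta>_def field_simps)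
  define k where "k = (\<lambda>y. a' / a * (y 0 - h y) + h' y)"
  define B' where "B' = {y \<in> space ?M. y(1 := \<beta> * y 1 + k y) \<in> B}"
  have [measurable]: "(\<lambda>x. x 0) \<in> borel_measurable ?M" "(\<lambda>x. x 1) \<in> borel_measurable ?M"
    using d by (auto intro!: measurable_component_singleton[where M = "\<lambda>_. lborel", simplified])
  have k [measurable]: "k \<in> borel_measurable ?M" unfolding k_def by measurable
  have "(\<lambda>x. \<beta> * x 1 + k x) \<in> borel_measurable ?M" by measurable
  then have [measurable]: "(\<lambda>x. x(1 := \<beta> * x 1 + k x)) \<in> measurable ?M ?M"
    using d by (intro measurable_fun_upd[where J="{..<d}"]) auto
  note B[measurable]
  have B': "B' \<in> sets ?M" unfolding B'_def by measurable
  have "{x \<in> space ?M. x(0 := a * x 0 + b * x 1 + h x, 1 := a' * x 0 + b' * x 1 + h' x) \<in> B} =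
      {x \<in> space ?M. x(0 := a * x 0 + (b * x 1 + h x)) \<in> B'}"
  proof -
    have "x(0 := a * x 0 + (b * x 1 + h x)) \<in> space ?M" if "x \<in> space ?M" for x
      using that d by (auto simp: space_PiM PiE_def extensional_def)
    moreover have "\<beta> * x 1 + k (x(0 := a * x 0 + (b * x 1 + h x))) = a' * x 0 + b' * x 1 + h' x" for x
      using a by (simp add: k_def ind \<beta>_def field_simps)
    ultimately show ?thesis unfolding B'_def by (auto simp: add.assoc)
  qed
  also have "emeasure ?M \<dots> = ennreal (1 / \<bar>a\<bar>) * emeasure ?M B'"
  proof (rule emeasure_affine_update)
    show "(\<lambda>x. b * x 1 + h x) \<in> borel_measurable ?M" by measurable
  qed (use d a B' in \<open>auto simp: ind\<close>)
  also have "emeasure ?M B' = ennreal (1 / \<bar>\<beta>\<bar>) * emeasure ?M B"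
    unfolding B'_def using d \<beta> B by (intro emeasure_affine_update) (auto simp: ind k_def simp del: One_nat_def)
  also have "ennreal (1 / \<bar>a\<bar>) * (ennreal (1 / \<bar>\<beta>\<bar>) * emeasure ?M B) = ennreal (1 / \<bar>a * \<beta>\<bar>) * emeasure ?M B"
    by (simp add: abs_mult mult.assoc[symmetric] flip: ennreal_mult)
  finally show ?thesis unfolding \<beta>(2) .
qed

section \<open>Simplices over planar triangles\<close>

lemma affine_fun_const: "affine_fun d (\<lambda>x. c)"
  unfolding affine_fun_def by (intro exI[of _ "\<lambda>_. 0"] exI[of _ c]) simp

lemma affine_fun_coord: "k < d \<Longrightarrow> affine_fun d (\<lambda>x. x k)"
  unfolding affine_fun_def
  by (intro exI[of _ "\<lambda>j. if j = k then 1 else 0"] exI[of _ 0]) (simp add: if_distrib[of "\<lambda>t. t * _"] cong: if_cong)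

lemma affine_fun_add:
  assumes "affine_fun d f" "affine_fun d g" shows "affine_fun d (\<lambda>x. f x + g x)"
proof -
  obtain A c where "\<And>x. f x = (\<Sum>j<d. A j * x j) + c" using assms by (auto simp: affine_fun_def)
  moreover obtain B e where "\<And>x. g x = (\<Sum>j<d. B j * x j) + e" using assms by (auto simp: affine_fun_def)
  ultimately show ?thesis unfolding affine_fun_def
    by (intro exI[of _ "\<lambda>j. A j + B j"] exI[of _ "c + e"]) (simp add: distrib_right sum.distrib)
qed

lemma affine_fun_cmult:
  assumes "affine_fun d f" shows "affine_fun d (\<lambda>x. k * f x)"
proof -
  obtain A c where "\<And>x. f x = (\<Sum>j<d. A j * x j) + c" using assms by (auto simp: affine_fun_def)
  then show ?thesis unfolding affine_fun_def
    by (intro exI[of _ "\<lambda>j. k * A j"] exI[of _ "k * c"]) (simp add: distrib_left sum_distrib_left mult.assoc)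
qed

lemma affine_fun_diff:
  assumes "affine_fun d f" "affine_fun d g" shows "affine_fun d (\<lambda>x. f x - g x)"
  using affine_fun_add[OF assms(1) affine_fun_cmult[OF assms(2), of "- 1"]] by simp

lemma affine_fun_sum:
  "(\<And>k. k \<in> K \<Longrightarrow> affine_fun d (f k)) \<Longrightarrow> affine_fun d (\<lambda>x. \<Sum>k\<in>K. f k x)"
  by (induction K rule: infinite_finite_induct) (auto intro: affine_fun_const affine_fun_add)

lemma affine_fun_measurable:
  assumes "affine_fun d f" shows "f \<in> borel_measurable (lebesgue_pi d)"
proof -
  obtain A c where f: "f = (\<lambda>x. (\<Sum>j<d. A j * x j) + c)"
    using assms by (auto simp: affine_fun_def fun_eq_iff)
  have [measurable]: "(\<lambda>x. x j) \<in> borel_measurable (lebesgue_pi d)" if "j \<in> {..<d}" for j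
    using measurable_component_singleton[OF that, of "\<lambda>_. lborel"] by simp
  show ?thesis unfolding f by measurable
qed

text \<open>
  In homogeneous planar coordinates \<open>(x 0, x 1, residual d x)\<close>, the hyperplane \<open>lift d (a, b, c)\<close> is the
  line \<open>a x + b y = c\<close>.
\<close>

definition residual :: "nat \<Rightarrow> (nat \<Rightarrow> real) \<Rightarrow> real" where
  "residual d x = 1 - (\<Sum>k\<in>{2..<d}. x k)"

definition lift :: "nat \<Rightarrow> real \<times> real \<times> real \<Rightarrow> (nat \<Rightarrow> real) set" where
  "lift d = (\<lambda>(a, b, c). {x \<in> rspace d. a * x 0 + b * x 1 = c * residual d x})"

definition coord_plane :: "nat \<Rightarrow> nat \<Rightarrow> (nat \<Rightarrow> real) set" where
  "coord_plane d k = {x \<in> rspace d. x k = 0}"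

definition std_simplex :: "nat \<Rightarrow> (nat \<Rightarrow> real) set" where
  "std_simplex d = {x \<in> rspace d. (\<forall>k<d. 0 < x k) \<and> (\<Sum>k<d. x k) < 1}"

lemma affine_fun_residual: "affine_fun d (residual d)"
  unfolding residual_def by (intro affine_fun_diff affine_fun_const affine_fun_sum affine_fun_coord) auto

lemma split_index_atMost:
  fixes f :: "nat \<Rightarrow> real"
  assumes "2 \<le> d" shows "(\<Sum>k\<le>d. f k) = f 0 + f 1 + f d + (\<Sum>k\<in>{2..<d}. f k)"
proof -
  have "{..d} = insert 0 (insert 1 (insert d {2..<d}))" using assms by auto
  then show ?thesis using assms by simp
qed

lemma split_index_lessThan:
  fixes f :: "nat \<Rightarrow> real"
  assumes "2 \<le> d" shows "(\<Sum>k<d. f k) = f 0 + f 1 + (\<Sum>k\<in>{2..<d}. f k)"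
proof -
  have "{..<d} = insert 0 (insert 1 {2..<d})" using assms by auto
  then show ?thesis by simp
qed

lemma space_lebesgue_pi: "space (lebesgue_pi d) = rspace d"
  by (simp add: space_PiM rspace_def)

definition planar_point :: "nat \<Rightarrow> real \<Rightarrow> real \<Rightarrow> nat \<Rightarrow> real" where
  "planar_point d s t = (\<lambda>j\<in>{..<d}. if j = 0 then s else if j = 1 then t else 0)"

definition unit_point :: "nat \<Rightarrow> nat \<Rightarrow> nat \<Rightarrow> real" where
  "unit_point d k = (\<lambda>j\<in>{..<d}. if j = k then 1 else 0)"

lemma point_in_rspace: "planar_point d s t \<in> rspace d" "unit_point d k \<in> rspace d"
  by (simp_all add: planar_point_def unit_point_def rspace_def)

lemma planar_point_simps:
  assumes "2 \<le> d"
  shows "planar_point d s t 0 = s" "planar_point d s t 1 = t"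
    "2 \<le> j \<Longrightarrow> j < d \<Longrightarrow> planar_point d s t j = 0" "residual d (planar_point d s t) = 1"
  using assms by (auto simp: planar_point_def residual_def)

lemma unit_point_simps:
  "j < d \<Longrightarrow> unit_point d k j = (if j = k then 1 else 0)"
  "2 \<le> k \<Longrightarrow> k < d \<Longrightarrow> residual d (unit_point d k) = 0"
  by (simp_all add: unit_point_def residual_def sum.delta)

text \<open>
  Three lines such that no two of them are parallel and not all three meet in a point. \<open>L1\<close>, \<open>L2\<close>, \<open>L3\<close> below
  are the barycentric coordinates of their triangle, homogenized; the normalizing factors \<open>m1\<close>, \<open>m2\<close>, \<open>m3\<close>,
  \<open>D\<close> come from Cramer's rule.
\<close>

locale planar_triangle =
  fixes d :: nat and a1 b1 c1 a2 b2 c2 a3 b3 c3 :: real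
  assumes dim: "2 \<le> d"
    and m1_ne: "a2 * b3 - a3 * b2 \<noteq> 0"
    and m2_ne: "a3 * b1 - a1 * b3 \<noteq> 0"
    and m3_ne: "a1 * b2 - a2 * b1 \<noteq> 0"
    and D_ne: "c1 * (a2 * b3 - a3 * b2) + c2 * (a3 * b1 - a1 * b3) + c3 * (a1 * b2 - a2 * b1) \<noteq> 0"
begin

definition "m1 = a2 * b3 - a3 * b2"
definition "m2 = a3 * b1 - a1 * b3"
definition "m3 = a1 * b2 - a2 * b1"
definition "D = c1 * m1 + c2 * m2 + c3 * m3"

lemma ne: "m1 \<noteq> 0" "m2 \<noteq> 0" "m3 \<noteq> 0" "D \<noteq> 0"
  using m1_ne m2_ne m3_ne D_ne by (simp_all add: m1_def m2_def m3_def D_def)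

definition L1 where "L1 x = m1 / D * (c1 * residual d x - a1 * x 0 - b1 * x 1)"
definition L2 where "L2 x = m2 / D * (c2 * residual d x - a2 * x 0 - b2 * x 1)"
definition L3 where "L3 x = m3 / D * (c3 * residual d x - a3 * x 0 - b3 * x 1)"

lemma L_sum: "L1 x + L2 x + L3 x = residual d x"
proof -
  have "L1 x + L2 x + L3 x = (D * residual d x) / D"
    by (simp add: L1_def L2_def L3_def add_divide_distrib[symmetric] D_def m1_def m2_def m3_def algebra_simps)
  then show ?thesis using ne by simp
qed

lemma L_affine: "affine_fun d L1" "affine_fun d L2" "affine_fun d L3"
  unfolding L1_def L2_def L3_def using dim
  by (intro affine_fun_cmult affine_fun_diff affine_fun_residual affine_fun_coord; simp)+

definition g :: "nat \<Rightarrow> (nat \<Rightarrow> real) \<Rightarrow> real" where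
  "g k x = (if k = 0 then L1 x else if k = 1 then L2 x else if k = d then L3 x else x k)"

text \<open>
  The indices \<open>0\<close>, \<open>1\<close> and \<open>d\<close> belong to the three planar vertices, and the indices \<open>k\<close> with
  \<open>2 \<le> k < d\<close> to the apexes. Thus \<open>x \<mapsto> (g 0 x, \<dots>, g (d - 1) x)\<close> maps the simplex to the standard simplex.
\<close>

definition V :: "nat \<Rightarrow> nat \<Rightarrow> real" where
  "V k = (if k = 0 then planar_point d ((c2 * b3 - c3 * b2) / m1) ((a2 * c3 - a3 * c2) / m1)
          else if k = 1 then planar_point d ((c3 * b1 - c1 * b3) / m2) ((a3 * c1 - a1 * c3) / m2)
          else if k = d then planar_point d ((c1 * b2 - c2 * b1) / m3) ((a1 * c2 - a2 * c1) / m3)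
          else (unit_point d k))"

lemma L_corner:
  "L1 (planar_point d s t) = m1 / D * (c1 - a1 * s - b1 * t)"
  "L2 (planar_point d s t) = m2 / D * (c2 - a2 * s - b2 * t)"
  "L3 (planar_point d s t) = m3 / D * (c3 - a3 * s - b3 * t)"
  by (simp_all add: L1_def L2_def L3_def planar_point_simps[OF dim] del: One_nat_def)

lemma L_unit:
  assumes "2 \<le> k" "k < d"
  shows "L1 (unit_point d k) = 0" "L2 (unit_point d k) = 0"
    "L3 (unit_point d k) = 0"
  using assms by (simp_all add: L1_def L2_def L3_def unit_point_simps)

lemma L_V:
  "L1 (V 0) = 1" "L2 (V 0) = 0" "L3 (V 0) = 0"
  "L1 (V 1) = 0" "L2 (V 1) = 1" "L3 (V 1) = 0"
  "L1 (V d) = 0" "L2 (V d) = 0" "L3 (V d) = 1"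
proof -
  have D: "D = m1 * c1 - a1 * (c2 * b3 - c3 * b2) - b1 * (a2 * c3 - a3 * c2)"
    "D = m2 * c2 - a2 * (c3 * b1 - c1 * b3) - b2 * (a3 * c1 - a1 * c3)"
    "D = m3 * c3 - a3 * (c1 * b2 - c2 * b1) - b3 * (a1 * c2 - a2 * c1)"
    by (simp_all add: D_def m1_def m2_def m3_def algebra_simps)
  have Vs: "V 0 = planar_point d ((c2 * b3 - c3 * b2) / m1) ((a2 * c3 - a3 * c2) / m1)"
    "V 1 = planar_point d ((c3 * b1 - c1 * b3) / m2) ((a3 * c1 - a1 * c3) / m2)"
    "V d = planar_point d ((c1 * b2 - c2 * b1) / m3) ((a1 * c2 - a2 * c1) / m3)"
    using dim by (simp_all add: V_def)
  \<comment> \<open>The coordinates of a vertex are fractions whose denominator is the minor of the two lines through it.\<close>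
  have one: "m / D * (c - a * (p / m) - b * (q / m)) = (m * c - a * p - b * q) / D"
    if "m \<noteq> 0" for m a b c p q :: real
  proof -
    have "c - a * (p / m) - b * (q / m) = (m * c - a * p - b * q) / m"
      using that by (simp add: field_simps)
    then show ?thesis using that by simp
  qed
  have zero: "n / D * (c - a * (p / m) - b * (q / m)) = 0"
    if "m \<noteq> 0" "m * c - a * p - b * q = 0" for m n a b c p q :: real
  proof -
    have "c - a * (p / m) - b * (q / m) = (m * c - a * p - b * q) / m"
      using that(1) by (simp add: field_simps)
    then show ?thesis using that(2) by simp
  qed
  show "L1 (V 0) = 1" "L2 (V 1) = 1" "L3 (V d) = 1"
    unfolding Vs L_corner using one ne D by simp_all
  show "L2 (V 0) = 0" "L3 (V 0) = 0" "L1 (V 1) = 0" "L3 (V 1) = 0" "L1 (V d) = 0" "L2 (V d) = 0"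
    unfolding Vs L_corner
    by (rule zero, rule ne, simp add: m1_def m2_def m3_def algebra_simps)+
qed

sublocale barycentric d "{..d}" g V
proof
  show "1 \<le> d" using dim by simp
  show "affine_fun d (g i)" if "i \<in> {..d}" for i
  proof -
    have "g i = L1 \<or> g i = L2 \<or> g i = L3 \<or> (g i = (\<lambda>x. x i) \<and> i < d)"
      using that by (auto simp: g_def fun_eq_iff)
    then show ?thesis using L_affine affine_fun_coord by auto
  qed
  show "V i \<in> rspace d" if "i \<in> {..d}" for i
    by (simp add: V_def point_in_rspace)
  show "g i (V k) = (if i = k then 1 else 0)" if ik: "i \<in> {..d}" "k \<in> {..d}" for i k
  proof (cases "2 \<le> k \<and> k < d")
    case True
    then have "V k = (unit_point d k)" by (simp add: V_def)
    then show ?thesis using True L_unit[of k] ik dim by (auto simp: g_def unit_point_simps)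
  next
    case False
    then have k: "k = 0 \<or> k = 1 \<or> k = d" using ik by auto
    have z: "V k j = 0" if "2 \<le> j" "j < d" for j
      using k dim that by (auto simp: V_def planar_point_def)
    show ?thesis
    proof (cases "2 \<le> i \<and> i < d")
      case True
      then show ?thesis using z[of i] False by (auto simp: g_def)
    next
      case i: False
      then have "i = 0 \<or> i = 1 \<or> i = d" using ik by auto
      then show ?thesis using k L_V dim by (auto simp: g_def)
    qed
  qed
  show "(\<Sum>k\<in>{..d}. g k x) = 1" if "x \<in> rspace d" for x
    using L_sum[of x] dim by (simp add: split_index_atMost g_def residual_def)
  show "x j = (\<Sum>k\<in>{..d}. g k x * V k j)" if x: "x \<in> rspace d" and j: "j < d" for x j
  proof (cases "2 \<le> j")
    case True
    have "(\<Sum>k\<in>{2..<d}. g k x * V k j) = (\<Sum>k\<in>{2..<d}. if k = j then x k else 0)"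
      using True j by (intro sum.cong) (auto simp: g_def V_def unit_point_simps)
    then show ?thesis using True j dim
      by (simp add: split_index_atMost V_def planar_point_simps[OF dim])
  next
    case False
    then have j01: "j = 0 \<or> j = 1" by auto
    have "(\<Sum>k\<in>{2..<d}. g k x * V k j) = 0"
      using j01 j by (intro sum.neutral) (auto simp: V_def unit_point_simps)
    then have sum: "(\<Sum>k\<in>{..d}. g k x * V k j) = L1 x * V 0 j + L2 x * V 1 j + L3 x * V d j"
      using dim by (simp add: split_index_atMost g_def)
    have c: "m / D * u * (p / m) = u * p / D" if "m \<noteq> 0" for m u p :: real
      using that by (simp add: field_simps)
    have "L1 x * V 0 j + L2 x * V 1 j + L3 x * V d j = D * x j / D"
    proof (cases "j = 0")
      case True
      have "L1 x * V 0 j + L2 x * V 1 j + L3 x * V d j =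
        (c1 * residual d x - a1 * x 0 - b1 * x 1) * (c2 * b3 - c3 * b2) / D +
        (c2 * residual d x - a2 * x 0 - b2 * x 1) * (c3 * b1 - c1 * b3) / D +
        (c3 * residual d x - a3 * x 0 - b3 * x 1) * (c1 * b2 - c2 * b1) / D"
        using True dim ne by (simp add: V_def planar_point_simps[OF dim] L1_def L2_def L3_def c)
      also have "\<dots> = D * x 0 / D"
        by (simp add: add_divide_distrib[symmetric] D_def m1_def m2_def m3_def algebra_simps)
      finally show ?thesis using True by simp
    next
      case False
      then have j1: "j = 1" using j01 by simp
      have "L1 x * V 0 j + L2 x * V 1 j + L3 x * V d j =
        (c1 * residual d x - a1 * x 0 - b1 * x 1) * (a2 * c3 - a3 * c2) / D +
        (c2 * residual d x - a2 * x 0 - b2 * x 1) * (a3 * c1 - a1 * c3) / D +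
        (c3 * residual d x - a3 * x 0 - b3 * x 1) * (a1 * c2 - a2 * c1) / D"
        using dim ne unfolding j1 by (simp add: V_def planar_point_simps[OF dim] L1_def L2_def L3_def c del: One_nat_def)
      also have "\<dots> = D * x 1 / D"
        by (simp add: add_divide_distrib[symmetric] D_def m1_def m2_def m3_def algebra_simps)
      finally show ?thesis using j1 by simp
    qed
    then show ?thesis unfolding sum using ne by simp
  qed
qed auto

lemma facets_eq:
  "facet ` {..d} = lift d ` {(a1, b1, c1), (a2, b2, c2), (a3, b3, c3)} \<union> coord_plane d ` {2..<d}"
proof -
  have "L1 x = 0 \<longleftrightarrow> a1 * x 0 + b1 * x 1 = c1 * residual d x"
    "L2 x = 0 \<longleftrightarrow> a2 * x 0 + b2 * x 1 = c2 * residual d x"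
    "L3 x = 0 \<longleftrightarrow> a3 * x 0 + b3 * x 1 = c3 * residual d x" for x
    using ne by (auto simp: L1_def L2_def L3_def)
  then have "facet 0 = lift d (a1, b1, c1)" "facet 1 = lift d (a2, b2, c2)" "facet d = lift d (a3, b3, c3)"
    using dim unfolding facet_def lift_def g_def by auto
  moreover have "facet k = coord_plane d k" if "k \<in> {2..<d}" for k
    using that by (auto simp: facet_def coord_plane_def g_def)
  moreover have "{..d} = {0, 1, d} \<union> {2..<d}" using dim by auto
  ultimately show ?thesis by (simp add: image_Un)
qed

lemma emeasure_open_simplex:
  assumes a1: "a1 \<noteq> 0"
  shows "emeasure (lebesgue_pi d) open_simplex =
         ennreal (D\<^sup>2 / \<bar>m1 * m2 * m3\<bar>) * emeasure (lebesgue_pi d) (std_simplex d)"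
proof -
  let ?M = "lebesgue_pi d"
  have comp [measurable]: "(\<lambda>x. x k) \<in> borel_measurable ?M" if "k \<in> {..<d}" for k
    using affine_fun_measurable[OF affine_fun_coord] that by simp
  have std: "std_simplex d \<in> sets ?M"
  proof -
    have "std_simplex d = {x \<in> space ?M. (\<forall>k\<in>{..<d}. 0 < x k) \<and> (\<Sum>k\<in>{..<d}. x k) < 1}"
      by (auto simp: std_simplex_def space_lebesgue_pi)
    also have "\<dots> \<in> sets ?M" by measurable
    finally show ?thesis .
  qed
  have [measurable]: "residual d \<in> borel_measurable ?M"
    by (rule affine_fun_measurable[OF affine_fun_residual])
  have res: "residual d (x(0 := s, 1 := t)) = residual d x" for x s t
    by (simp add: residual_def)
  define \<alpha> \<beta> \<alpha>' \<beta>' where "\<alpha> = - (m1 / D * a1)" and "\<beta> = - (m1 / D * b1)"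
    and "\<alpha>' = - (m2 / D * a2)" and "\<beta>' = - (m2 / D * b2)"
  define h h' where "h = (\<lambda>x. m1 / D * c1 * residual d x)" and "h' = (\<lambda>x. m2 / D * c2 * residual d x)"
  have L12: "L1 x = \<alpha> * x 0 + \<beta> * x 1 + h x" "L2 x = \<alpha>' * x 0 + \<beta>' * x 1 + h' x" for x
  proof -
    have "k * (c * r - a * s - b * t) = - (k * a) * s + - (k * b) * t + k * c * r"
      for k c r a s b t :: real by (simp add: algebra_simps)
    then show "L1 x = \<alpha> * x 0 + \<beta> * x 1 + h x" "L2 x = \<alpha>' * x 0 + \<beta>' * x 1 + h' x"
      unfolding L1_def L2_def \<alpha>_def \<beta>_def \<alpha>'_def \<beta>'_def h_def h'_def by blast+
  qed
  have det: "\<alpha> * \<beta>' - \<alpha>' * \<beta> = m1 * m2 * m3 / D\<^sup>2"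
    by (simp add: \<alpha>_def \<beta>_def \<alpha>'_def \<beta>'_def m3_def power2_eq_square algebra_simps diff_divide_distrib)
  have "open_simplex = {x \<in> space ?M. x(0 := L1 x, 1 := L2 x) \<in> std_simplex d}"
  proof -
    have mem: "x(0 := L1 x, 1 := L2 x) \<in> rspace d" if "x \<in> rspace d" for x
      using that dim by (auto simp: rspace_def PiE_def extensional_def)
    have pos: "(\<forall>k<d. 0 < (x(0 := L1 x, 1 := L2 x)) k) \<longleftrightarrow> 0 < L1 x \<and> 0 < L2 x \<and> (\<forall>k\<in>{2..<d}. 0 < x k)" for x
    proof -
      have "{..<d} = {0, 1} \<union> {2..<d}" using dim by auto
      then have "(\<forall>k<d. P k) \<longleftrightarrow> P 0 \<and> P 1 \<and> (\<forall>k\<in>{2..<d}. P k)" for P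
        by (metis Un_iff empty_iff insert_iff lessThan_iff)
      then show ?thesis by simp
    qed
    have sum: "(\<Sum>k<d. (x(0 := L1 x, 1 := L2 x)) k) < 1 \<longleftrightarrow> 0 < L3 x" for x
      using L_sum[of x] dim by (simp add: split_index_lessThan residual_def) linarith
    have "(\<forall>i\<in>{..d}. 0 < g i x) \<longleftrightarrow> 0 < L1 x \<and> 0 < L2 x \<and> 0 < L3 x \<and> (\<forall>k\<in>{2..<d}. 0 < x k)" for x
    proof -
      have "{..d} = {0, 1, d} \<union> {2..<d}" using dim by auto
      then show ?thesis using dim by (auto simp: g_def)
    qed
    then show ?thesis
      unfolding open_simplex_def std_simplex_def space_lebesgue_pi using mem pos sum by auto
  qed
  also have "emeasure ?M \<dots> = ennreal (1 / \<bar>\<alpha> * \<beta>' - \<alpha>' * \<beta>\<bar>) * emeasure ?M (std_simplex d)"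
    unfolding L12
  proof (rule emeasure_planar_substitution[OF dim std])
    show "h \<in> borel_measurable ?M" "h' \<in> borel_measurable ?M" unfolding h_def h'_def by measurable
    show "h (x(0 := s, 1 := t)) = h x" "h' (x(0 := s, 1 := t)) = h' x" for x s t
      unfolding h_def h'_def res by (rule refl)+
    show "\<alpha> \<noteq> 0" using a1 ne by (simp add: \<alpha>_def)
    show "\<alpha> * \<beta>' - \<alpha>' * \<beta> \<noteq> 0" unfolding det using ne by simp
  qed
  also have "1 / \<bar>\<alpha> * \<beta>' - \<alpha>' * \<beta>\<bar> = D\<^sup>2 / \<bar>m1 * m2 * m3\<bar>"
    unfolding det by (simp add: abs_divide)
  finally show ?thesis .
qed

lemma volume_open_simplex:
  assumes "a1 \<noteq> 0"
  shows "volume d open_simplex = D\<^sup>2 / \<bar>m1 * m2 * m3\<bar> * volume d (std_simplex d)"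
  unfolding volume_def measure_def emeasure_open_simplex[OF assms] by (simp add: enn2real_mult)

end

section \<open>Arrangements over planar lines\<close>

lemma lift_Pair: "lift d (a, b, c) = {x \<in> rspace d. a * x 0 + b * x 1 = c * residual d x}"
  by (simp add: lift_def)

lemma hyperplane_lift:
  assumes d: "2 \<le> d" and ab: "(a, b) \<noteq> (0, 0)"
  shows "hyperplane d (lift d (a, b, c))"
proof -
  define f where "f = (\<lambda>x. a * x 0 + b * x 1 - c * residual d x)"
  have "affine_fun d f"
    unfolding f_def using d
    by (intro affine_fun_diff affine_fun_add affine_fun_cmult affine_fun_coord affine_fun_residual) auto
  moreover have "f (planar_point d a b) - f (planar_point d 0 0) = a * a + b * b"
    by (simp add: f_def planar_point_simps[OF d] del: One_nat_def)
  then have "f (planar_point d a b) \<noteq> f (planar_point d 0 0)"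
    using ab by (auto simp: sum_squares_eq_zero_iff)
  ultimately have "hyperplane d {x \<in> rspace d. f x = 0}"
    using hyperplane_affine_fun point_in_rspace by blast
  then show ?thesis by (simp add: lift_Pair f_def)
qed

lemma hyperplane_coord_plane:
  assumes "k < d" shows "hyperplane d (coord_plane d k)"
  unfolding coord_plane_def
proof (rule hyperplane_affine_fun[where x = "unit_point d k" and y = "planar_point d 0 0"])
  show "unit_point d k k \<noteq> planar_point d 0 0 k"
    using assms by (simp add: unit_point_simps) (simp add: planar_point_def)
qed (simp_all add: point_in_rspace affine_fun_coord assms)

text \<open>
  From the common point of the two lines, move along the first line: this leaves the second one.
\<close>

lemma lift_neq:
  assumes d: "2 \<le> d" and m: "a1 * b2 - a2 * b1 \<noteq> 0"
  shows "lift d (a1, b1, c1) \<noteq> lift d (a2, b2, c2)"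
proof
  assume eq: "lift d (a1, b1, c1) = lift d (a2, b2, c2)"
  define m s t where "m = a1 * b2 - a2 * b1" and "s = (c1 * b2 - c2 * b1) / m" and "t = (a1 * c2 - a2 * c1) / m"
  have "m \<noteq> 0" using m by (simp add: m_def)
  then have eq_m: "m * (a * s + b * t) = a * (c1 * b2 - c2 * b1) + b * (a1 * c2 - a2 * c1)" for a b
    by (simp add: s_def t_def distrib_left)
  have "m * (a1 * s + b1 * t) = m * c1" "m * (a2 * s + b2 * t) = m * c2"
    unfolding eq_m by (simp_all add: m_def algebra_simps)
  then have 1: "a1 * s + b1 * t = c1" and 2: "a2 * s + b2 * t = c2"
    using \<open>m \<noteq> 0\<close> by auto
  have "planar_point d (s - b1) (t + a1) \<in> lift d (a1, b1, c1)"
    using 1 by (simp add: lift_Pair point_in_rspace planar_point_simps[OF d] algebra_simps del: One_nat_def)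
  then have "planar_point d (s - b1) (t + a1) \<in> lift d (a2, b2, c2)" by (simp only: eq)
  then have "a2 * (s - b1) + b2 * (t + a1) = c2"
    by (simp add: lift_Pair planar_point_simps[OF d] del: One_nat_def)
  then show False using 2 m by (simp add: algebra_simps)
qed

lemma unit_point_in_lift:
  assumes "2 \<le> k" "k < d" shows "unit_point d k \<in> lift d p"
  using assms by (cases p) (auto simp: lift_Pair point_in_rspace unit_point_simps)

lemma unit_point_in_coord_plane:
  assumes "k < d" "j < d" shows "unit_point d k \<in> coord_plane d j \<longleftrightarrow> j \<noteq> k"
  using assms by (auto simp: coord_plane_def point_in_rspace unit_point_simps)

definition arrangement :: "nat \<Rightarrow> (real \<times> real \<times> real) set \<Rightarrow> (nat \<Rightarrow> real) set set" where
  "arrangement d A = lift d ` A \<union> coord_plane d ` {2..<d}"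

lemma lift_notin_coord_planes: "lift d p \<notin> coord_plane d ` {2..<d}"
proof
  assume "lift d p \<in> coord_plane d ` {2..<d}"
  then obtain k where k: "2 \<le> k" "k < d" "lift d p = coord_plane d k" by auto
  then show False
    using unit_point_in_lift[OF k(1,2), of p] unit_point_in_coord_plane[OF k(2) k(2)] by simp
qed

lemma disjoint_lift_coord_planes: "lift d ` A \<inter> coord_plane d ` {2..<d} = {}"
  using lift_notin_coord_planes by fast

lemma inj_on_coord_plane: "inj_on (coord_plane d) {2..<d}"
proof (rule inj_onI)
  fix i k assume ik: "i \<in> {2..<d}" "k \<in> {2..<d}" "coord_plane d i = coord_plane d k"
  then show "i = k"
    using unit_point_in_coord_plane[of i d i] unit_point_in_coord_plane[of i d k]
    by (metis atLeastLessThan_iff)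
qed

lemma card_arrangement:
  assumes "finite A" and "inj_on (lift d) A"
  shows "card (arrangement d A) = card A + (d - 2)"
proof -
  have "card (arrangement d A) = card (lift d ` A) + card (coord_plane d ` {2..<d})"
    unfolding arrangement_def using assms(1)
    by (intro card_Un_disjoint disjoint_lift_coord_planes) simp_all
  then show ?thesis
    by (simp add: card_image[OF assms(2)] card_image[OF inj_on_coord_plane])
qed

lemma arrangement_inj:
  assumes "inj_on (lift d) A" "P \<subseteq> A" "Q \<subseteq> A" "arrangement d P = arrangement d Q"
  shows "P = Q"
proof -
  have "lift d ` R = arrangement d R - coord_plane d ` {2..<d}" for R
    using disjoint_lift_coord_planes[of d R] unfolding arrangement_def by fast
  then have "lift d ` P = lift d ` Q" by (simp only: assms(4))
  then show ?thesis by (simp only: inj_on_image_eq_iff[OF assms(1-3)])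
qed

text \<open>
  The apex \<open>unit_point d k\<close> lies on all hyperplanes of the arrangement other than \<open>coord_plane d k\<close>,
  so a simplex has to use that one as well.
\<close>

lemma simplex_subset_arrangement:
  assumes inj: "inj_on (lift d) A" and d: "2 \<le> d"
    and S: "S \<subseteq> arrangement d A" "forms_simplex d S"
  obtains T where "T \<subseteq> A" "card T = 3" "S = arrangement d T"
proof -
  have card: "card S = d + 1" and empty: "\<Inter>S = {}"
    using S(2) by (auto simp: forms_simplex_def)
  have "coord_plane d k \<in> S" if k: "k \<in> {2..<d}" for k
  proof (rule ccontr)
    assume "coord_plane d k \<notin> S"
    have "unit_point d k \<in> P" if P: "P \<in> S" for P
    proof -
      have "P \<in> lift d ` A \<or> (\<exists>j\<in>{2..<d}. P = coord_plane d j)"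
        using S(1) P unfolding arrangement_def by blast
      moreover have "unit_point d k \<in> P" if "P \<in> lift d ` A"
        using that k unit_point_in_lift[of k d] by auto
      moreover have "unit_point d k \<in> P" if "j \<in> {2..<d}" "P = coord_plane d j" for j
      proof -
        have "j \<noteq> k" using \<open>coord_plane d k \<notin> S\<close> P that by auto
        then show ?thesis using that k unit_point_in_coord_plane[of k d j] by simp
      qed
      ultimately show ?thesis by blast
    qed
    then show False using empty by blast
  qed
  then have sub: "coord_plane d ` {2..<d} \<subseteq> S" by blast
  define T where "T = {p \<in> A. lift d p \<in> S}"
  have ST: "S = arrangement d T"
  proof
    show "S \<subseteq> arrangement d T" using S(1) unfolding T_def arrangement_def by blast
    show "arrangement d T \<subseteq> S" using sub unfolding T_def arrangement_def by blast
  qed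
  have injT: "inj_on (lift d) T" using inj by (rule inj_on_subset) (auto simp: T_def)
  have "finite S" using card by (metis Suc_eq_plus1 card.infinite nat.simps(3))
  then have "finite (lift d ` T)" using ST by (auto simp: arrangement_def)
  then have "finite T" using injT by (rule finite_imageD)
  then have "card T = 3"
    using card_arrangement[OF _ injT] card d ST by simp
  moreover have "T \<subseteq> A" by (auto simp: T_def)
  ultimately show thesis using that ST by blast
qed

text \<open>
  If the determinant vanishes, then the common point of the first two lines lies on the third one and, having
  all further coordinates 0, on all hyperplanes of the arrangement.
\<close>

lemma concurrent_not_simplex:
  assumes d: "2 \<le> d" and m: "a1 * b2 - a2 * b1 \<noteq> 0"
    and D: "c1 * (a2 * b3 - a3 * b2) + c2 * (a3 * b1 - a1 * b3) + c3 * (a1 * b2 - a2 * b1) = 0"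
  shows "\<not> forms_simplex d (arrangement d {(a1, b1, c1), (a2, b2, c2), (a3, b3, c3)})"
proof -
  define m s t where "m = a1 * b2 - a2 * b1" and "s = (c1 * b2 - c2 * b1) / m" and "t = (a1 * c2 - a2 * c1) / m"
  have m0: "m \<noteq> 0" using m by (simp add: m_def)
  have eq_m: "m * (a * s + b * t) = a * (c1 * b2 - c2 * b1) + b * (a1 * c2 - a2 * c1)" for a b
    using m0 by (simp add: s_def t_def distrib_left)
  have "m * (a1 * s + b1 * t) = m * c1" "m * (a2 * s + b2 * t) = m * c2"
    "m * (a3 * s + b3 * t) = m * c3 -
      (c1 * (a2 * b3 - a3 * b2) + c2 * (a3 * b1 - a1 * b3) + c3 * (a1 * b2 - a2 * b1))"
    unfolding eq_m by (simp_all add: m_def algebra_simps)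
  then have "m * (a1 * s + b1 * t) = m * c1" "m * (a2 * s + b2 * t) = m * c2"
    "m * (a3 * s + b3 * t) = m * c3"
    unfolding D by simp_all
  then have eqs: "a1 * s + b1 * t = c1" "a2 * s + b2 * t = c2" "a3 * s + b3 * t = c3"
    using m0 by auto
  have "planar_point d s t \<in> lift d p" if "p \<in> {(a1, b1, c1), (a2, b2, c2), (a3, b3, c3)}" for p
    using that eqs
    by (auto simp: lift_Pair point_in_rspace planar_point_simps[OF d] simp del: One_nat_def)
  moreover have "planar_point d s t \<in> coord_plane d k" if "k \<in> {2..<d}" for k
    using that by (simp add: coord_plane_def point_in_rspace planar_point_simps[OF d])
  ultimately have "planar_point d s t \<in> P"
    if "P \<in> arrangement d {(a1, b1, c1), (a2, b2, c2), (a3, b3, c3)}" for P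
    using that unfolding arrangement_def by blast
  then show ?thesis unfolding forms_simplex_def by blast
qed


section \<open>The determinant inequalities\<close>

text \<open>A concave function that is nonnegative at both ends of an interval is nonnegative on it.\<close>

lemma concave_quadratic_nonneg:
  fixes A B C q Q :: real
  assumes "0 \<le> C" and "0 \<le> q" "q \<le> Q" and "0 \<le> A" and "0 \<le> A + B * Q - C * Q\<^sup>2"
  shows "0 \<le> A + B * q - C * q\<^sup>2"
proof (cases "Q = 0")
  case False
  then have Q: "Q > 0" using assms by simp
  have "0 \<le> (Q - q) * A + q * (A + B * Q - C * Q\<^sup>2) + Q * (C * q * (Q - q))"
    using assms by (intro add_nonneg_nonneg mult_nonneg_nonneg) auto
  also have "\<dots> = Q * (A + B * q - C * q\<^sup>2)"
    by (simp add: algebra_simps power2_eq_square)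
  finally show ?thesis using Q by (simp add: zero_le_mult_iff)
qed (use assms in auto)

text \<open>
  A number with \<open>\<zeta>\<^sup>4 + \<zeta>\<^sup>2 = 1\<close>. It is \<open>1 / sqrt \<phi>\<close> for the golden ratio \<open>\<phi>\<close>, which
  enters as the ratio of a diagonal to a side of the regular pentagon.
\<close>

definition \<zeta> :: real where "\<zeta> = sqrt ((sqrt 5 - 1) / 2)"

lemma zeta_pos: "0 < \<zeta>" by (simp add: \<zeta>_def)

lemma zeta_pow4: "\<zeta> ^ 4 = 1 - \<zeta>\<^sup>2"
proof -
  have z2: "\<zeta>\<^sup>2 = (sqrt 5 - 1) / 2" by (simp add: \<zeta>_def)
  have "\<zeta> ^ 4 = (\<zeta>\<^sup>2)\<^sup>2" by (simp flip: power_mult)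
  also have "\<dots> = 1 - \<zeta>\<^sup>2" unfolding z2 by (simp add: power2_eq_square field_simps)
  finally show ?thesis .
qed

lemma zeta_pow6: "\<zeta> ^ 6 = 2 * \<zeta>\<^sup>2 - 1"
proof -
  have "\<zeta> ^ 6 = \<zeta> ^ 4 * \<zeta>\<^sup>2" by (simp flip: power_add)
  also have "\<dots> = (1 - \<zeta>\<^sup>2) * \<zeta>\<^sup>2" by (simp only: zeta_pow4)
  also have "\<dots> = \<zeta>\<^sup>2 - \<zeta> ^ 4" by (simp add: algebra_simps eval_nat_numeral)
  also have "\<dots> = 2 * \<zeta>\<^sup>2 - 1" by (simp only: zeta_pow4)
  finally show ?thesis .
qed

lemma zeta_less_1: "\<zeta> < 1"
proof (rule ccontr)
  assume "\<not> \<zeta> < 1"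
  then have "1 \<le> \<zeta> ^ 4" "1 \<le> \<zeta>\<^sup>2" by (simp_all add: one_le_power)
  then show False using zeta_pow4 by simp
qed

lemma zeta_bounds: "78 / 100 < \<zeta>" "\<zeta> < 79 / 100"
proof -
  have mono: "a ^ 4 + a\<^sup>2 < b ^ 4 + b\<^sup>2" if "0 \<le> a" "a < b" for a b :: real
    using that by (intro add_strict_mono power_strict_mono) auto
  show "78 / 100 < \<zeta>"
  proof (rule ccontr)
    assume "\<not> ?thesis"
    then have "\<zeta> ^ 4 + \<zeta>\<^sup>2 \<le> (78 / 100) ^ 4 + (78 / 100)\<^sup>2"
      using zeta_pos by (intro add_mono power_mono) auto
    then show False using zeta_pow4 by (simp add: power2_eq_square power4_eq_xxxx)
  qed
  show "\<zeta> < 79 / 100"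
  proof (rule ccontr)
    assume "\<not> ?thesis"
    then have "(79 / 100) ^ 4 + (79 / 100)\<^sup>2 \<le> \<zeta> ^ 4 + \<zeta>\<^sup>2"
      by (intro add_mono power_mono) auto
    then show False using zeta_pow4 by (simp add: power2_eq_square power4_eq_xxxx)
  qed
qed

lemma zeta_sq_bounds: "6084 / 10000 < \<zeta>\<^sup>2" "\<zeta>\<^sup>2 < 6241 / 10000"
proof -
  have "(78 / 100)\<^sup>2 < \<zeta>\<^sup>2" by (rule power_strict_mono[OF zeta_bounds(1)]) auto
  then show "6084 / 10000 < \<zeta>\<^sup>2" by (simp add: power_divide)
  have "\<zeta>\<^sup>2 < (79 / 100)\<^sup>2" using zeta_pos by (intro power_strict_mono[OF zeta_bounds(2)]) auto
  then show "\<zeta>\<^sup>2 < 6241 / 10000" by (simp add: power_divide)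
qed

text \<open>
  For three lines \<open>\<alpha>\<^sup>2 x + \<beta>\<^sup>2 y = c \<alpha> \<beta>\<close> with increasing quotients \<open>\<beta> / \<alpha>\<close>, let \<open>x\<close> and \<open>y\<close> be the
  quotients of the first two and of the last two of these numbers. Up to a common factor,
  \<open>det_form\<^sup>2\<close> is the squared determinant of the three lines and \<open>minor_form\<close> is the product of the
  absolute values of the three minors of their normal vectors. Both are symmetric under reversal of the order,
  which corresponds to exchanging the two coordinates of the plane.

  A line with \<open>c = 1\<close> is called far, one with \<open>c = \<zeta>\<^sup>3\<close> is called near. The following lemmas are named after
  the kinds of the three lines in this order.
\<close>

abbreviation det_form :: "real \<Rightarrow> real \<Rightarrow> real \<Rightarrow> real \<Rightarrow> real \<Rightarrow> real" where
  "det_form c1 c2 c3 x y \<equiv> c1 * x * (1 - y\<^sup>2) - c2 * (1 - x\<^sup>2 * y\<^sup>2) + c3 * y * (1 - x\<^sup>2)"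

abbreviation minor_form :: "real \<Rightarrow> real \<Rightarrow> real" where
  "minor_form x y \<equiv> (1 - x\<^sup>2) * (1 - y\<^sup>2) * (1 - x\<^sup>2 * y\<^sup>2)"

lemma det_form_same:
  assumes "0 \<le> x" "x < 1" "0 \<le> y" "y < 1" "0 \<le> c" "c \<le> 1"
  shows "(det_form c c c x y)\<^sup>2 \<le> minor_form x y"
proof -
  have eq: "det_form c c c x y = - c * ((1 - x) * (1 - y) * (1 - x * y))"
    by (simp add: power2_eq_square algebra_simps)
  have xy: "0 \<le> x * y" "x * y \<le> 1" using assms by (simp_all add: mult_le_one)
  have c2: "c\<^sup>2 \<le> 1" using assms by (simp add: power_le_one)
  have sq: "(1 - t)\<^sup>2 \<le> 1 - t\<^sup>2" if "0 \<le> t" "t \<le> 1" for t :: real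
  proof -
    have "0 \<le> 2 * t * (1 - t)" using that by simp
    then show ?thesis by (simp add: power2_eq_square algebra_simps)
  qed
  have "(det_form c c c x y)\<^sup>2 = c\<^sup>2 * ((1 - x)\<^sup>2 * (1 - y)\<^sup>2 * (1 - x * y)\<^sup>2)"
    unfolding eq by (simp add: power_mult_distrib)
  also have "\<dots> \<le> 1 * ((1 - x)\<^sup>2 * (1 - y)\<^sup>2 * (1 - x * y)\<^sup>2)"
    using c2 by (intro mult_right_mono) auto
  also have "\<dots> \<le> 1 * ((1 - x\<^sup>2) * (1 - y\<^sup>2) * (1 - (x * y)\<^sup>2))"
    using assms xy sq by (intro mult_mono mult_nonneg_nonneg) (auto simp: power_le_one)
  finally show ?thesis by (simp add: power_mult_distrib)
qed

text \<open>
  Equality holds for \<open>x = y = \<zeta>\<close>, where the three lines belong to one pentagon. In terms of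
  \<open>p = x * y\<close> and \<open>q = x + y\<close>, both sides have the factor \<open>1 - p\<close>, and the remaining difference is a concave
  quadratic function of \<open>q\<close>. So only the ends of the range of \<open>q\<close> for given \<open>p\<close> matter; at the upper end one of
  \<open>x\<close>, \<open>y\<close> equals \<open>\<zeta>\<close>.
\<close>

lemma det_form_far_near_far:
  assumes "0 \<le> x" "x \<le> \<zeta>" "0 \<le> y" "y \<le> \<zeta>"
  shows "(det_form 1 (\<zeta> ^ 3) 1 x y)\<^sup>2 \<le> minor_form x y"
proof -
  define p q where "p = x * y" and "q = x + y"
  have \<zeta>: "0 < \<zeta>" "\<zeta> < 1" by (rule zeta_pos zeta_less_1)+
  have p: "0 \<le> p" "p \<le> \<zeta>\<^sup>2" "p < 1"
  proof -
    show "0 \<le> p" using assms by (simp add: p_def)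
    show "p \<le> \<zeta>\<^sup>2" using assms \<zeta> unfolding p_def power2_eq_square by (intro mult_mono) auto
    also have "\<zeta>\<^sup>2 < 1" using \<zeta> by (simp add: power_less_one_iff)
    finally show "p < 1" .
  qed
  have q: "0 \<le> q" "q \<le> \<zeta> + p / \<zeta>"
  proof -
    show "0 \<le> q" using assms by (simp add: q_def)
    have "0 \<le> (\<zeta> - x) * (\<zeta> - y)" using assms by simp
    then show "q \<le> \<zeta> + p / \<zeta>" using \<zeta> by (simp add: p_def q_def field_simps)
  qed
  define A where "A = (1 + p) ^ 3 - \<zeta> ^ 6 * (1 + p)\<^sup>2 * (1 - p)"
  define B where "B = 2 * \<zeta> ^ 3 * (1 + p) * (1 - p)"
  have key: "0 \<le> A + B * q - 2 * q\<^sup>2"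
  proof (rule concave_quadratic_nonneg[OF _ q])
    have "\<zeta> ^ 6 * (1 + p)\<^sup>2 * (1 - p) \<le> 1 * (1 + p)\<^sup>2 * (1 + p)"
      using \<zeta> p by (intro mult_mono) (auto simp: power_le_one)
    then show "0 \<le> A" by (simp add: A_def power2_eq_square power3_eq_cube)
    \<comment> \<open>Everything is rational in \<open>Z\<close>, and \<open>Z * Z = 1 - Z\<close> reduces it to a linear expression in \<open>Z\<close>.\<close>
    define Z where "Z = \<zeta>\<^sup>2"
    have "Z * Z = \<zeta> ^ 4" by (simp add: Z_def eval_nat_numeral)
    then have Z2: "Z * Z = 1 - Z" by (simp only: zeta_pow4 Z_def)
    have Z: "0 < Z" "Z < 1" using \<zeta> by (simp_all add: Z_def power_less_one_iff)
    have inv: "1 / Z = 1 + Z" using Z Z2 by (simp add: field_simps)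
    have "\<zeta> ^ 6 = Z * Z * Z" by (simp add: Z_def eval_nat_numeral)
    also have "\<dots> = 2 * Z - 1" unfolding Z2 by (simp add: left_diff_distrib Z2)
    finally have A: "A = (1 + p) ^ 3 - (2 * Z - 1) * (1 + p)\<^sup>2 * (1 - p)"
      by (simp add: A_def)
    have "B * (\<zeta> + p / \<zeta>) = 2 * (Z * Z + p * Z) * (1 + p) * (1 - p)"
      using \<zeta> by (simp add: B_def Z_def field_simps eval_nat_numeral)
    then have B: "B * (\<zeta> + p / \<zeta>) = 2 * (1 - Z + p * Z) * (1 + p) * (1 - p)"
      unfolding Z2 .
    have "(\<zeta> + p / \<zeta>)\<^sup>2 = Z + 2 * p + p\<^sup>2 * (1 / Z)"
      using \<zeta> by (simp add: Z_def field_simps power2_eq_square)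
    then have C: "(\<zeta> + p / \<zeta>)\<^sup>2 = Z + 2 * p + p\<^sup>2 * (1 + Z)"
      unfolding inv .
    have "A + B * (\<zeta> + p / \<zeta>) - 2 * (\<zeta> + p / \<zeta>)\<^sup>2 = (4 - 6 * Z) - 2 * (1 - Z) * p\<^sup>2"
      unfolding A B C by (simp add: algebra_simps power2_eq_square power3_eq_cube)
    moreover have "p * p \<le> Z * Z"
      using p by (intro mult_mono) (auto simp: Z_def)
    then have "p\<^sup>2 \<le> 1 - Z"
      by (simp only: Z2 power2_eq_square)
    then have "2 * (1 - Z) * p\<^sup>2 \<le> 2 * (1 - Z) * (1 - Z)"
      using Z by (intro mult_left_mono) auto
    moreover have "2 * (1 - Z) * (1 - Z) = 4 - 6 * Z"
      using Z2 by (simp add: algebra_simps)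
    ultimately show "0 \<le> A + B * (\<zeta> + p / \<zeta>) - 2 * (\<zeta> + p / \<zeta>)\<^sup>2" by simp
  qed simp
  have g: "det_form 1 (\<zeta> ^ 3) 1 x y = (1 - p) * (q - \<zeta> ^ 3 * (1 + p))"
    by (simp add: p_def q_def algebra_simps power2_eq_square)
  have b: "minor_form x y = ((1 + p)\<^sup>2 - q\<^sup>2) * (1 + p) * (1 - p)"
    by (simp add: p_def q_def algebra_simps power2_eq_square)
  have "minor_form x y - (det_form 1 (\<zeta> ^ 3) 1 x y)\<^sup>2 = (1 - p) * (A + B * q - 2 * q\<^sup>2)"
    unfolding g b A_def B_def by (simp add: algebra_simps eval_nat_numeral)
  moreover have "0 \<le> (1 - p) * (A + B * q - 2 * q\<^sup>2)" using key p by simp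
  ultimately show ?thesis by linarith
qed

text \<open>
  The argument is the one for \<open>det_form_far_near_far\<close>. The bound \<open>x * y \<le> \<zeta> ^ 4\<close> cannot be dropped:
  two near lines must not be as close to a far line between them as two far lines are to a near
  line between them.
\<close>

lemma det_form_near_far_near:
  assumes "0 \<le> x" "x \<le> \<zeta>" "0 \<le> y" "y \<le> \<zeta>" "x * y \<le> \<zeta> ^ 4"
  shows "(det_form (\<zeta> ^ 3) 1 (\<zeta> ^ 3) x y)\<^sup>2 \<le> minor_form x y"
proof -
  define p q where "p = x * y" and "q = x + y"
  have \<zeta>: "0 < \<zeta>" "\<zeta> < 1" by (rule zeta_pos zeta_less_1)+
  have p: "0 \<le> p" "p \<le> \<zeta> ^ 4" "p < 1"
  proof -
    show "0 \<le> p" using assms by (simp add: p_def)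
    show "p \<le> \<zeta> ^ 4" using assms by (simp add: p_def)
    also have "\<zeta> ^ 4 < 1" using \<zeta> by (simp add: power_less_one_iff)
    finally show "p < 1" .
  qed
  have q: "0 \<le> q" "q \<le> \<zeta> + p / \<zeta>"
  proof -
    show "0 \<le> q" using assms by (simp add: q_def)
    have "0 \<le> (\<zeta> - x) * (\<zeta> - y)" using assms by simp
    then show "q \<le> \<zeta> + p / \<zeta>" using \<zeta> by (simp add: p_def q_def field_simps)
  qed
  define A where "A = (1 + p) ^ 3 - (1 + p)\<^sup>2 * (1 - p)"
  define B where "B = 2 * \<zeta> ^ 3 * (1 + p) * (1 - p)"
  define C where "C = (1 + p) + \<zeta> ^ 6 * (1 - p)"
  have key: "0 \<le> A + B * q - C * q\<^sup>2"
  proof (rule concave_quadratic_nonneg[OF _ q])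
    show "0 \<le> C" using \<zeta> p by (simp add: C_def)
    have "(1 + p)\<^sup>2 * (1 - p) \<le> (1 + p)\<^sup>2 * (1 + p)"
      using \<zeta> p by (intro mult_left_mono) auto
    then show "0 \<le> A" by (simp add: A_def power2_eq_square power3_eq_cube)
    define Z where "Z = \<zeta>\<^sup>2"
    have "Z * Z = \<zeta> ^ 4" by (simp add: Z_def eval_nat_numeral)
    then have Z2: "Z * Z = 1 - Z" by (simp only: zeta_pow4 Z_def)
    have Z: "0 < Z" "Z < 1" using \<zeta> by (simp_all add: Z_def power_less_one_iff)
    have inv: "1 / Z = 1 + Z" using Z Z2 by (simp add: field_simps)
    have "\<zeta> ^ 6 = Z * Z * Z" by (simp add: Z_def eval_nat_numeral)
    also have "\<dots> = 2 * Z - 1" unfolding Z2 by (simp add: left_diff_distrib Z2)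
    finally have C': "C = (1 + p) + (2 * Z - 1) * (1 - p)"
      by (simp add: C_def)
    have "B * (\<zeta> + p / \<zeta>) = 2 * (Z * Z + p * Z) * (1 + p) * (1 - p)"
      using \<zeta> by (simp add: B_def Z_def field_simps eval_nat_numeral)
    then have B: "B * (\<zeta> + p / \<zeta>) = 2 * (1 - Z + p * Z) * (1 + p) * (1 - p)"
      unfolding Z2 .
    have "(\<zeta> + p / \<zeta>)\<^sup>2 = Z + 2 * p + p\<^sup>2 * (1 / Z)"
      using \<zeta> by (simp add: Z_def field_simps power2_eq_square)
    then have D: "(\<zeta> + p / \<zeta>)\<^sup>2 = Z + 2 * p + p\<^sup>2 * (1 + Z)"
      unfolding inv .
    have "C * (\<zeta> + p / \<zeta>)\<^sup>2 = 2 * (Z * Z) + 4 * p * Z + 2 * (Z + Z * Z) * p\<^sup>2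
        + 2 * p * (Z - Z * Z) + 4 * (1 - Z) * p\<^sup>2 + 2 * p ^ 3 * (1 - Z * Z)"
      unfolding C' D by (simp add: algebra_simps power2_eq_square power3_eq_cube)
    also have "\<dots> = (2 - 2 * Z) + (8 * Z - 2) * p + (6 - 4 * Z) * p\<^sup>2 + 2 * Z * p ^ 3"
      unfolding Z2 by (simp add: algebra_simps)
    finally have "A + B * (\<zeta> + p / \<zeta>) - C * (\<zeta> + p / \<zeta>)\<^sup>2 =
        p * ((4 - 6 * Z) * (1 - p) - (4 * Z - 2) * p\<^sup>2)"
      unfolding A_def B by (simp add: algebra_simps power2_eq_square power3_eq_cube)
    moreover have "(4 * Z - 2) * p\<^sup>2 \<le> (4 - 6 * Z) * (1 - p)"
    proof -
      have Zb: "6084 / 10000 < Z" "Z < 6241 / 10000"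
        unfolding Z_def by (rule zeta_sq_bounds)+
      have pZ: "p \<le> 1 - Z" using p zeta_pow4 by (simp add: Z_def)
      have "p\<^sup>2 \<le> (1 - Z) * (1 - Z)"
        unfolding power2_eq_square using p pZ Z by (intro mult_mono) auto
      also have "\<dots> = 2 - 3 * Z" using Z2 by (simp add: algebra_simps)
      finally have "(4 * Z - 2) * p\<^sup>2 \<le> (4 * Z - 2) * (2 - 3 * Z)"
        using Zb by (intro mult_left_mono) auto
      also have "\<dots> = 14 * Z - 4 - 12 * (Z * Z)"
        by (simp add: algebra_simps)
      also have "\<dots> \<le> 4 * Z - 6 * (Z * Z)" unfolding Z2 using Zb by simp
      also have "\<dots> = (4 - 6 * Z) * Z" by (simp add: algebra_simps)
      also have "\<dots> \<le> (4 - 6 * Z) * (1 - p)"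
        using Zb pZ by (intro mult_left_mono) auto
      finally show ?thesis .
    qed
    ultimately show "0 \<le> A + B * (\<zeta> + p / \<zeta>) - C * (\<zeta> + p / \<zeta>)\<^sup>2" using p by simp
  qed
  have g: "det_form (\<zeta> ^ 3) 1 (\<zeta> ^ 3) x y = - (1 - p) * ((1 + p) - \<zeta> ^ 3 * q)"
    by (simp add: p_def q_def algebra_simps power2_eq_square)
  have b: "minor_form x y = ((1 + p)\<^sup>2 - q\<^sup>2) * (1 + p) * (1 - p)"
    by (simp add: p_def q_def algebra_simps power2_eq_square)
  have "minor_form x y - (det_form (\<zeta> ^ 3) 1 (\<zeta> ^ 3) x y)\<^sup>2 = (1 - p) * (A + B * q - C * q\<^sup>2)"
    unfolding g b A_def B_def C_def by (simp add: algebra_simps eval_nat_numeral)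
  moreover have "0 \<le> (1 - p) * (A + B * q - C * q\<^sup>2)" using key p by simp
  ultimately show ?thesis by linarith
qed

text \<open>
  Equality holds for \<open>x = \<zeta>\<close>, \<open>y = 0\<close>: the last line is then an axis. Dividing by this extreme case,
  \<open>t\<^sup>2 \<le> 1 - x\<^sup>2\<close>, leaves an inequality in \<open>y\<close> alone, which holds with room to spare.
\<close>

lemma det_form_near_far_far:
  assumes "0 \<le> x" "x \<le> \<zeta>" "0 \<le> y" "y < 1"
  shows "(det_form (\<zeta> ^ 3) 1 1 x y)\<^sup>2 \<le> minor_form x y"
proof -
  have \<zeta>: "0 < \<zeta>" "\<zeta> < 1" by (rule zeta_pos zeta_less_1)+
  define t where "t = 1 - \<zeta> ^ 3 * x"
  define e where "e = x - \<zeta> ^ 3"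
  have x1: "x < 1" using assms \<zeta> by simp
  have det_form: "det_form (\<zeta> ^ 3) 1 1 x y = - (1 - y) * (t + x * y * e)"
    by (simp add: t_def e_def algebra_simps power2_eq_square)
  have z3x: "\<zeta> ^ 3 * x \<le> \<zeta> ^ 4"
    using assms \<zeta> by (simp add: power4_eq_xxxx power3_eq_cube mult_left_mono)
  have tpos: "1 - \<zeta> ^ 4 \<le> t" using z3x by (simp add: t_def)
  moreover have "\<zeta> ^ 4 < 1" using \<zeta> by (simp add: power_less_one_iff)
  ultimately have t0: "0 < t" by linarith
  have t2: "t\<^sup>2 \<le> 1 - x\<^sup>2"
  proof -
    have "x * (1 + \<zeta> ^ 6) \<le> \<zeta> * (1 + \<zeta> ^ 6)" using assms \<zeta> by (intro mult_right_mono) auto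
    also have "\<dots> = 2 * \<zeta> ^ 3" unfolding zeta_pow6 by (simp add: algebra_simps eval_nat_numeral)
    finally have "x * (x * (1 + \<zeta> ^ 6)) \<le> x * (2 * \<zeta> ^ 3)" using assms by (intro mult_left_mono)
    then show ?thesis by (simp add: t_def algebra_simps eval_nat_numeral)
  qed
  have e: "\<bar>x * e\<bar> \<le> t / 2"
  proof -
    have "x * e \<le> \<zeta> * (\<zeta> - \<zeta> ^ 3)"
    proof (cases "e \<ge> 0")
      case True
      then show ?thesis using assms \<zeta> by (intro mult_mono) (auto simp: e_def)
    next
      case False
      then have "x * e \<le> 0" using assms by (simp add: mult_nonneg_nonpos)
      also have "0 \<le> \<zeta> * (\<zeta> - \<zeta> ^ 3)" using \<zeta> by (simp add: power_le_one_iff power3_eq_cube mult_le_one)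
      finally show ?thesis .
    qed
    also have "\<dots> = \<zeta>\<^sup>2 - \<zeta> ^ 4" by (simp add: algebra_simps eval_nat_numeral)
    also have "\<dots> = \<zeta> ^ 6" using zeta_pow4 zeta_pow6 by simp
    finally have 1: "x * e \<le> \<zeta> ^ 6" .
    \<comment> \<open>The minimum of \<open>x * e = x\<^sup>2 - \<zeta> ^ 3 * x\<close> is at \<open>x = \<zeta> ^ 3 / 2\<close>.\<close>
    have "0 \<le> (x - \<zeta> ^ 3 / 2)\<^sup>2 + 3 / 4 * (\<zeta> ^ 3 * \<zeta> ^ 3)" by simp
    then have 2: "- (x * e) \<le> \<zeta> ^ 6"
      by (simp add: e_def algebra_simps eval_nat_numeral)
    have "\<zeta> ^ 6 \<le> (1 - \<zeta> ^ 4) / 2" using zeta_pow4 zeta_pow6 zeta_sq_bounds by simp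
    also have "\<dots> \<le> t / 2" by (rule divide_right_mono[OF tpos]) simp
    finally have "\<zeta> ^ 6 \<le> t / 2" .
    then have "x * e \<le> t / 2" "- (x * e) \<le> t / 2" using 1 2 by linarith+
    then show ?thesis by (rule abs_leI)
  qed
  have "\<bar>t + x * y * e\<bar> \<le> t * (1 + y / 2)"
  proof -
    have "\<bar>t + x * y * e\<bar> \<le> \<bar>t\<bar> + \<bar>x * e\<bar> * y"
      using assms(3) abs_triangle_ineq[of t "x * y * e"] by (simp add: abs_mult algebra_simps)
    also have "\<dots> \<le> t + t / 2 * y"
      using e t0 assms(3) by (intro add_mono mult_right_mono) auto
    finally show ?thesis by (simp add: algebra_simps)
  qed
  then have "(t + x * y * e)\<^sup>2 \<le> (t * (1 + y / 2))\<^sup>2"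
    by (metis abs_ge_zero power2_abs power_mono)
  also have "\<dots> = t\<^sup>2 * (1 + y / 2)\<^sup>2" by (simp add: power_mult_distrib)
  also have "\<dots> \<le> (1 - x\<^sup>2) * (1 + y / 2)\<^sup>2"
    using t2 by (intro mult_right_mono) auto
  finally have sq: "(t + x * y * e)\<^sup>2 \<le> (1 - x\<^sup>2) * (1 + y / 2)\<^sup>2" .
  have x2: "x\<^sup>2 \<le> 79 / 100 * (79 / 100)" 
    unfolding power2_eq_square using assms zeta_bounds by (intro mult_mono) auto
  have "(1 - y) * (1 + y / 2)\<^sup>2 \<le> (1 + y) * (1 - x\<^sup>2 * y\<^sup>2)"
  proof -
    have "x\<^sup>2 * y\<^sup>2 \<le> 79 / 100 * (79 / 100) * y\<^sup>2"
      using x2 by (intro mult_right_mono) auto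
    then have "(1 + y) * (1 - 79 / 100 * (79 / 100) * y\<^sup>2) \<le> (1 + y) * (1 - x\<^sup>2 * y\<^sup>2)"
      using assms by (intro mult_left_mono) auto
    moreover have "y ^ 3 \<le> y" using power_decreasing[of 1 3 y] assms by simp
    moreover have "(1 - y) * (1 + y / 2)\<^sup>2 = 1 - 3 / 4 * y\<^sup>2 - y ^ 3 / 4"
      by (simp add: field_simps eval_nat_numeral)
    moreover have "(1 + y) * (1 - 79 / 100 * (79 / 100) * y\<^sup>2) = 1 + y - 6241 / 10000 * y\<^sup>2 - 6241 / 10000 * y ^ 3"
      by (simp add: algebra_simps eval_nat_numeral)
    moreover have "0 \<le> y" "0 \<le> y\<^sup>2" "0 \<le> y ^ 3" using assms by auto
    ultimately show ?thesis by linarith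
  qed
  then have "(1 - y) * ((1 - y) * (1 + y / 2)\<^sup>2) \<le> (1 - y) * ((1 + y) * (1 - x\<^sup>2 * y\<^sup>2))"
    using assms by (intro mult_left_mono) auto
  then have "(1 - x\<^sup>2) * ((1 - y) * ((1 - y) * (1 + y / 2)\<^sup>2)) \<le> (1 - x\<^sup>2) * ((1 - y) * ((1 + y) * (1 - x\<^sup>2 * y\<^sup>2)))"
    using assms x1 by (intro mult_left_mono) (auto simp: power_le_one)
  moreover have "(det_form (\<zeta> ^ 3) 1 1 x y)\<^sup>2 \<le> (1 - y)\<^sup>2 * ((1 - x\<^sup>2) * (1 + y / 2)\<^sup>2)"
    unfolding det_form power_mult_distrib power2_minus using sq by (rule mult_left_mono) simp
  ultimately show ?thesis
    by (simp add: power2_eq_square algebra_simps)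
qed

text \<open>
  The determinant splits off the factor \<open>1 - x\<close>, and the other factor is so small, at most \<open>\<zeta>\<^sup>3 (1 + x)\<close> in
  absolute value, that there is room to spare.
\<close>

lemma det_form_near_near_far:
  assumes "0 \<le> x" "x < 1" "0 \<le> y" "y \<le> \<zeta>"
  shows "(det_form (\<zeta> ^ 3) (\<zeta> ^ 3) 1 x y)\<^sup>2 \<le> minor_form x y"
proof -
  have \<zeta>: "0 < \<zeta>" "\<zeta> < 1" by (rule zeta_pos zeta_less_1)+
  define Q where "Q = y * (1 + x) - \<zeta> ^ 3 * (1 + x * y\<^sup>2)"
  have det_form: "det_form (\<zeta> ^ 3) (\<zeta> ^ 3) 1 x y = (1 - x) * Q"
    by (simp add: Q_def algebra_simps power2_eq_square)
  have "Q \<le> \<zeta> ^ 3 * (1 + x)"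
  proof -
    have "0 \<le> (\<zeta> - y) * ((1 - \<zeta> ^ 3 * (\<zeta> + y)) * x + 1)"
    proof -
      have "\<zeta> ^ 3 * (\<zeta> + y) \<le> \<zeta> ^ 3 * (\<zeta> + \<zeta>)" using assms \<zeta> by (intro mult_left_mono) auto
      also have "\<dots> = 2 * \<zeta> ^ 4" by (simp add: eval_nat_numeral)
      also have "\<dots> \<le> 1" using zeta_pow4 zeta_sq_bounds by simp
      finally show ?thesis using assms by (intro mult_nonneg_nonneg add_nonneg_nonneg) auto
    qed
    then have "Q \<le> \<zeta> * (1 + x) - \<zeta> ^ 3 * (1 + x * \<zeta>\<^sup>2)"
      by (simp add: Q_def algebra_simps eval_nat_numeral)
    also have "\<dots> = \<zeta> * (1 - \<zeta>\<^sup>2) + x * \<zeta> * (1 - \<zeta> ^ 4)"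
      by (simp add: algebra_simps eval_nat_numeral)
    also have "\<dots> = \<zeta> ^ 3 * (\<zeta>\<^sup>2 + x)"
    proof -
      have *: "1 - \<zeta>\<^sup>2 = \<zeta> ^ 4" "1 - \<zeta> ^ 4 = \<zeta>\<^sup>2" using zeta_pow4 by simp_all
      have "\<zeta> * \<zeta> ^ 4 + x * \<zeta> * \<zeta>\<^sup>2 = \<zeta> ^ 3 * (\<zeta>\<^sup>2 + x)"
        by (simp add: algebra_simps eval_nat_numeral)
      then show ?thesis unfolding * .
    qed
    also have "\<dots> \<le> \<zeta> ^ 3 * (1 + x)" using \<zeta> by (intro mult_left_mono) (auto simp: power_le_one)
    finally show ?thesis .
  qed
  moreover have "- Q \<le> \<zeta> ^ 3 * (1 + x)"
  proof -
    have "y\<^sup>2 * x \<le> 1 * x" using assms \<zeta> by (intro mult_right_mono) (auto simp: power_le_one)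
    then have "\<zeta> ^ 3 * (1 + x * y\<^sup>2) \<le> \<zeta> ^ 3 * (1 + x)"
      using \<zeta> by (intro mult_left_mono) (auto simp: mult.commute)
    moreover have "0 \<le> y * (1 + x)" using assms by simp
    ultimately show ?thesis by (simp add: Q_def)
  qed
  ultimately have "Q\<^sup>2 \<le> (\<zeta> ^ 3 * (1 + x))\<^sup>2"
    by (metis abs_le_iff abs_le_square_iff abs_ge_self order_trans)
  also have "\<dots> = \<zeta>\<^sup>2 * (\<zeta> ^ 4 * (1 + x)\<^sup>2)" by (simp add: power_mult_distrib flip: power_mult power_add)
  also have "\<dots> \<le> \<zeta>\<^sup>2 * ((1 - y\<^sup>2) * (1 + x)\<^sup>2)"
    using assms power_mono[of y \<zeta> 2] by (intro mult_left_mono mult_right_mono) (auto simp: zeta_pow4)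
  finally have Q: "Q\<^sup>2 \<le> \<zeta>\<^sup>2 * ((1 - y\<^sup>2) * (1 + x)\<^sup>2)" .
  have y2: "y\<^sup>2 \<le> 1" using assms \<zeta> by (simp add: power_le_one)
  have x2: "x\<^sup>2 \<le> 1" using assms by (simp add: power_le_one)
  have "(det_form (\<zeta> ^ 3) (\<zeta> ^ 3) 1 x y)\<^sup>2 \<le> (1 - x)\<^sup>2 * (\<zeta>\<^sup>2 * ((1 - y\<^sup>2) * (1 + x)\<^sup>2))"
    unfolding det_form power_mult_distrib using Q by (intro mult_left_mono) auto
  also have "\<dots> = (1 - x\<^sup>2) * (1 - y\<^sup>2) * (\<zeta>\<^sup>2 * (1 - x\<^sup>2))"
    by (simp add: algebra_simps power2_eq_square)
  also have "\<dots> \<le> minor_form x y"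
  proof (intro mult_left_mono mult_nonneg_nonneg)
    have "\<zeta>\<^sup>2 * (1 - x\<^sup>2) \<le> 1 * (1 - x\<^sup>2)"
      using \<zeta> x2 by (intro mult_right_mono) (auto simp: power_le_one)
    also have "\<dots> \<le> 1 - x\<^sup>2 * y\<^sup>2" using y2 mult_left_mono[of "y\<^sup>2" 1 "x\<^sup>2"] by simp
    finally show "\<zeta>\<^sup>2 * (1 - x\<^sup>2) \<le> 1 - x\<^sup>2 * y\<^sup>2" .
  qed (use x2 y2 in auto)
  finally show ?thesis .
qed

section \<open>A family of lines with many triangles of maximum area\<close>

text \<open>
  The lines number 0 and 1 are the axes. The others have \<open>\<beta> / \<alpha> = \<zeta> ^ level\<close>, where the levels
  are the numbers not congruent to 3 modulo 4, so that the levels \<open>4 b\<close>, \<open>4 b + 1\<close>, \<open>4 b + 2\<close>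
  belong to one pentagon. The omitted levels keep different near lines at ratio at most \<open>\<zeta> ^ 4\<close>.
\<close>

definition level :: "nat \<Rightarrow> nat" where "level k = k + k div 3"

lemma level_eq: "level k = 4 * (k div 3) + k mod 3"
  using mult_div_mod_eq[of 3 k] by (simp add: level_def)

lemma level_less_iff: "level k < level l \<longleftrightarrow> k < l"
proof -
  have "strict_mono level"
    unfolding level_def by (intro strict_monoI add_less_le_mono div_le_mono) auto
  then show ?thesis by (rule strict_mono_less)
qed

definition \<alpha> :: "nat \<Rightarrow> real" where "\<alpha> i = (if i = 1 then 0 else 1)"
definition \<beta> :: "nat \<Rightarrow> real" where
  "\<beta> i = (if i = 0 then 0 else if i = 1 then 1 else \<zeta> ^ level (i - 2))"
definition near :: "nat \<Rightarrow> bool" where "near i \<longleftrightarrow> 2 \<le> i \<and> (i - 2) mod 3 = 1"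
definition \<kappa> :: "nat \<Rightarrow> real" where "\<kappa> i = (if near i then \<zeta> ^ 3 else 1)"
definition line :: "nat \<Rightarrow> real \<times> real \<times> real" where
  "line i = ((\<alpha> i)\<^sup>2, (\<beta> i)\<^sup>2, \<kappa> i * \<alpha> i * \<beta> i)"

definition steeper :: "nat \<Rightarrow> nat \<Rightarrow> bool" where
  "steeper i j \<longleftrightarrow> \<beta> i * \<alpha> j < \<beta> j * \<alpha> i"

lemma beta_bounds: "0 \<le> \<beta> i" "\<beta> i \<le> 1" "i \<noteq> 0 \<Longrightarrow> 0 < \<beta> i"
  using zeta_pos zeta_less_1 by (auto simp: \<beta>_def power_le_one less_imp_le)

lemma steeper_iff:
  "steeper i j \<longleftrightarrow> (if j = 1 then i \<noteq> 1 else if i = 0 then j \<noteq> 0 else j \<noteq> 0 \<and> i \<noteq> 1 \<and> j < i)"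
proof -
  have "\<zeta> ^ p < \<zeta> ^ q \<longleftrightarrow> q < p" for p q
    using zeta_pos zeta_less_1 by (simp add: power_strict_decreasing_iff)
  then show ?thesis
    using zeta_pos level_less_iff by (auto simp: steeper_def \<alpha>_def \<beta>_def not_less)
qed

lemma steeper_total: "i \<noteq> j \<Longrightarrow> steeper i j \<or> steeper j i"
  by (auto simp: steeper_iff)

lemma steeper_trans: "steeper i j \<Longrightarrow> steeper j k \<Longrightarrow> steeper i k"
  by (auto simp: steeper_iff split: if_splits)

lemma steeper_antisym: "steeper i j \<Longrightarrow> \<not> steeper j i"
  by (auto simp: steeper_iff split: if_splits)

definition ratio :: "nat \<Rightarrow> nat \<Rightarrow> real" where "ratio i j = \<beta> i * \<alpha> j / \<beta> j"

text \<open>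
  Near lines have levels congruent to 1 modulo 4 and far lines have even levels, which
  determines how close two lines can be. Ratios that involve an axis are 0.
\<close>

lemma steeper_ratio:
  assumes "steeper i j"
  shows "\<alpha> i = 1" "0 < \<beta> j" "0 \<le> ratio i j" "ratio i j < 1"
    "near i \<noteq> near j \<Longrightarrow> ratio i j \<le> \<zeta>"
    "near i \<Longrightarrow> near j \<Longrightarrow> ratio i j \<le> \<zeta> ^ 4"
proof -
  show \<alpha>: "\<alpha> i = 1" and beta_j: "0 < \<beta> j"
    using assms beta_bounds(3)[of j] by (auto simp: steeper_iff \<alpha>_def split: if_splits)
  show "0 \<le> ratio i j" using beta_bounds[of i] beta_j by (simp add: ratio_def \<alpha>_def)
  show "ratio i j < 1" using assms \<alpha> beta_j by (simp add: ratio_def steeper_def)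
  \<comment> \<open>Here \<open>n\<close> bounds the difference of the levels from below.\<close>
  have gen: "ratio i j \<le> \<zeta> ^ n" if "2 \<le> i \<Longrightarrow> 2 \<le> j \<Longrightarrow> n + level (j - 2) \<le> level (i - 2)" for n
  proof (cases "i = 0 \<or> j = 1")
    case True
    then show ?thesis using zeta_pos by (auto simp: ratio_def \<beta>_def \<alpha>_def)
  next
    case False
    then have ij: "2 \<le> i" "2 \<le> j" using assms by (auto simp: steeper_iff split: if_splits)
    have "\<zeta> ^ level (i - 2) \<le> \<zeta> ^ (n + level (j - 2))"
      using that[OF ij] zeta_pos zeta_less_1 by (intro power_decreasing) auto
    then show ?thesis using ij zeta_pos by (simp add: ratio_def \<beta>_def \<alpha>_def power_add field_simps)
  qed
  have less: "level (j - 2) < level (i - 2)" if "2 \<le> i" "2 \<le> j"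
    using assms that level_less_iff by (auto simp: steeper_iff split: if_splits)
  have "ratio i j \<le> \<zeta> ^ 1" by (rule gen) (use less in fastforce)
  then show "ratio i j \<le> \<zeta>" by simp
  show "ratio i j \<le> \<zeta> ^ 4" if nn: "near i" "near j"
  proof (rule gen)
    assume "2 \<le> i" "2 \<le> j"
    then have "level (j - 2) < level (i - 2)" by (rule less)
    then show "4 + level (j - 2) \<le> level (i - 2)"
      using nn by (simp add: level_eq near_def)
  qed
qed

definition normalized_det :: "nat \<Rightarrow> nat \<Rightarrow> nat \<Rightarrow> real" where
  "normalized_det i j k = det_form (\<kappa> i) (\<kappa> j) (\<kappa> k) (ratio i j) (ratio j k)"

definition normalized_minors :: "nat \<Rightarrow> nat \<Rightarrow> nat \<Rightarrow> real" where
  "normalized_minors i j k = minor_form (ratio i j) (ratio j k)"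

lemma ratio_mult:
  assumes "steeper i j" "steeper j k" shows "ratio i j * ratio j k = ratio i k"
  using steeper_ratio(1,2)[OF assms(1)] steeper_ratio(1,2)[OF assms(2)] by (simp add: ratio_def)

lemma form_reflect: "det_form c1 c2 c3 x y = det_form c3 c2 c1 y x" "minor_form x y = minor_form y x"
  by (simp_all add: algebra_simps)

text \<open>
  Axes count as far lines. They enter with ratio 0, which obeys all bounds on the ratios.
\<close>

lemma normalized_det_sq_le:
  assumes ij: "steeper i j" and jk: "steeper j k"
  shows "(normalized_det i j k)\<^sup>2 \<le> normalized_minors i j k"
proof -
  define x y where "x = ratio i j" and "y = ratio j k"
  have x: "0 \<le> x" "x < 1" and y: "0 \<le> y" "y < 1"
    using steeper_ratio(3,4)[OF ij] steeper_ratio(3,4)[OF jk] by (simp_all add: x_def y_def)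
  have xz: "x \<le> \<zeta>" if "near i \<noteq> near j"
    using steeper_ratio(5)[OF ij that] by (simp add: x_def)
  have yz: "y \<le> \<zeta>" if "near j \<noteq> near k"
    using steeper_ratio(5)[OF jk that] by (simp add: y_def)
  have xyz: "x * y \<le> \<zeta> ^ 4" if "near i" "near k"
    using steeper_ratio(6)[OF steeper_trans[OF ij jk] that] ratio_mult[OF ij jk]
    by (simp add: x_def y_def)
  have z3: "0 \<le> \<zeta> ^ 3" "\<zeta> ^ 3 \<le> 1" using zeta_pos zeta_less_1 by (simp_all add: power_le_one)
  have "(det_form (\<kappa> i) (\<kappa> j) (\<kappa> k) x y)\<^sup>2 \<le> minor_form x y"
  proof (cases "near i"; cases "near j"; cases "near k")
    assume "near i" "near j" "near k"
    then show ?thesis unfolding \<kappa>_def using det_form_same[OF x y z3] by simp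
  next
    assume n: "near i" "near j" "\<not> near k"
    then show ?thesis unfolding \<kappa>_def using det_form_near_near_far[OF x y(1) yz] by simp
  next
    assume n: "near i" "\<not> near j" "near k"
    then show ?thesis unfolding \<kappa>_def using det_form_near_far_near[OF x(1) xz y(1) yz xyz] by simp
  next
    assume n: "near i" "\<not> near j" "\<not> near k"
    then show ?thesis unfolding \<kappa>_def using det_form_near_far_far[OF x(1) xz y] by simp
  next
    assume n: "\<not> near i" "near j" "near k"
    have "(det_form 1 (\<zeta> ^ 3) (\<zeta> ^ 3) x y)\<^sup>2 \<le> minor_form x y"
      unfolding form_reflect(1)[where x = x and y = y] form_reflect(2)[of x y]
      by (rule det_form_near_near_far[OF y x(1) xz]) (use n in simp)
    then show ?thesis using n by (simp add: \<kappa>_def)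
  next
    assume n: "\<not> near i" "near j" "\<not> near k"
    then show ?thesis unfolding \<kappa>_def using det_form_far_near_far[OF x(1) xz y(1) yz] by simp
  next
    assume n: "\<not> near i" "\<not> near j" "near k"
    have "(det_form 1 1 (\<zeta> ^ 3) x y)\<^sup>2 \<le> minor_form x y"
      unfolding form_reflect(1)[where x = x and y = y] form_reflect(2)[of x y]
      by (rule det_form_near_far_far[OF y(1) yz x]) (use n in simp)
    then show ?thesis using n by (simp add: \<kappa>_def)
  next
    assume "\<not> near i" "\<not> near j" "\<not> near k"
    then show ?thesis unfolding \<kappa>_def using det_form_same[OF x y, of 1] by simp
  qed
  then show ?thesis by (simp add: normalized_det_def normalized_minors_def x_def y_def)
qed

lemma normalized_minors_pos:
  assumes ij: "steeper i j" and jk: "steeper j k"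
  shows "0 < normalized_minors i j k"
proof -
  have "(ratio i j)\<^sup>2 < 1" "(ratio j k)\<^sup>2 < 1" 
    using steeper_ratio(3,4)[OF ij] steeper_ratio(3,4)[OF jk] by (simp_all add: power_less_one_iff)
  moreover have "(ratio i j)\<^sup>2 * (ratio j k)\<^sup>2 < 1"
    unfolding power_mult_distrib[symmetric] ratio_mult[OF ij jk]
    using steeper_ratio(3,4)[OF steeper_trans[OF ij jk]] by (simp add: power_less_one_iff)
  ultimately show ?thesis unfolding normalized_minors_def by simp
qed

text \<open>
  The quotient in the last equation is the area of the triangle in units of the
  area of the triangle with vertices \<open>(0, 0)\<close>, \<open>(1, 0)\<close>, \<open>(0, 1)\<close>.
\<close>

lemma line_determinants:
  assumes ij: "steeper i j" and jk: "steeper j k"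
  defines "x \<equiv> ratio i j" and "y \<equiv> ratio j k"
  defines "m1 \<equiv> (\<alpha> j)\<^sup>2 * (\<beta> k)\<^sup>2 - (\<alpha> k)\<^sup>2 * (\<beta> j)\<^sup>2"
    and "m2 \<equiv> (\<alpha> k)\<^sup>2 * (\<beta> i)\<^sup>2 - (\<alpha> i)\<^sup>2 * (\<beta> k)\<^sup>2"
    and "m3 \<equiv> (\<alpha> i)\<^sup>2 * (\<beta> j)\<^sup>2 - (\<alpha> j)\<^sup>2 * (\<beta> i)\<^sup>2"
  shows "m1 \<noteq> 0" "m2 \<noteq> 0" "m3 \<noteq> 0"
    and "\<kappa> i * \<alpha> i * \<beta> i * m1 + \<kappa> j * \<alpha> j * \<beta> j * m2 + \<kappa> k * \<alpha> k * \<beta> k * m3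
      = \<beta> j * (\<beta> k)\<^sup>2 * normalized_det i j k"
    and "(\<beta> j * (\<beta> k)\<^sup>2 * normalized_det i j k)\<^sup>2 / \<bar>m1 * m2 * m3\<bar> = (normalized_det i j k)\<^sup>2 / normalized_minors i j k"
proof -
  have \<alpha>: "\<alpha> i = 1" "\<alpha> j = 1" and \<beta>: "0 < \<beta> j" "0 < \<beta> k"
    using steeper_ratio(1,2)[OF ij] steeper_ratio(1,2)[OF jk] by auto
  have beta_i: "\<beta> i = x * \<beta> j" and beta_j: "\<alpha> k * \<beta> j = y * \<beta> k"
    using \<alpha> \<beta> by (simp_all add: x_def y_def ratio_def)
  have x: "0 \<le> x" "x < 1" and y: "0 \<le> y" "y < 1" 
    using steeper_ratio(3,4)[OF ij] steeper_ratio(3,4)[OF jk] by (simp_all add: x_def y_def)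
  have m1: "m1 = (\<beta> k)\<^sup>2 * (1 - y\<^sup>2)"
  proof -
    have "m1 = (\<beta> k)\<^sup>2 - (\<alpha> k * \<beta> j)\<^sup>2" by (simp add: m1_def \<alpha> power_mult_distrib)
    then show ?thesis unfolding beta_j by (simp add: power_mult_distrib algebra_simps)
  qed
  have m2: "m2 = - ((\<beta> k)\<^sup>2 * (1 - x\<^sup>2 * y\<^sup>2))"
  proof -
    have "m2 = x\<^sup>2 * (\<alpha> k * \<beta> j)\<^sup>2 - (\<beta> k)\<^sup>2" by (simp add: m2_def \<alpha> beta_i power_mult_distrib)
    then show ?thesis unfolding beta_j by (simp add: power_mult_distrib algebra_simps)
  qed
  have m3: "m3 = (\<beta> j)\<^sup>2 * (1 - x\<^sup>2)"
    by (simp add: m3_def \<alpha> beta_i power_mult_distrib algebra_simps)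
  have cap: "normalized_minors i j k = (1 - x\<^sup>2) * (1 - y\<^sup>2) * (1 - x\<^sup>2 * y\<^sup>2)"
    by (simp add: normalized_minors_def x_def y_def)
  have cpos: "0 < normalized_minors i j k" by (rule normalized_minors_pos[OF ij jk])
  then have ne: "1 - x\<^sup>2 \<noteq> 0" "1 - y\<^sup>2 \<noteq> 0" "1 - x\<^sup>2 * y\<^sup>2 \<noteq> 0" unfolding cap by force+
  show "m1 \<noteq> 0" "m2 \<noteq> 0" "m3 \<noteq> 0" unfolding m1 m2 m3 using \<beta> ne by simp_all
  have "\<kappa> k * \<alpha> k * \<beta> k * m3 = \<beta> j * (\<beta> k)\<^sup>2 * (\<kappa> k * y * (1 - x\<^sup>2))"
  proof -
    have "\<kappa> k * \<alpha> k * \<beta> k * m3 = \<kappa> k * \<beta> k * \<beta> j * (\<alpha> k * \<beta> j) * (1 - x\<^sup>2)"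
      unfolding m3 by (simp add: power2_eq_square)
    then show ?thesis unfolding beta_j by (simp add: power2_eq_square algebra_simps)
  qed
  then show "\<kappa> i * \<alpha> i * \<beta> i * m1 + \<kappa> j * \<alpha> j * \<beta> j * m2 + \<kappa> k * \<alpha> k * \<beta> k * m3
      = \<beta> j * (\<beta> k)\<^sup>2 * normalized_det i j k"
    unfolding m1 m2 by (simp add: \<alpha> beta_i normalized_det_def x_def[symmetric] y_def[symmetric] algebra_simps)
  have "m1 * m2 * m3 = - ((\<beta> j * (\<beta> k)\<^sup>2)\<^sup>2 * normalized_minors i j k)"
    unfolding m1 m2 m3 cap by (simp add: power_mult_distrib power2_eq_square)
  then have "\<bar>m1 * m2 * m3\<bar> = (\<beta> j * (\<beta> k)\<^sup>2)\<^sup>2 * normalized_minors i j k"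
    using cpos by (simp add: abs_mult)
  then show "(\<beta> j * (\<beta> k)\<^sup>2 * normalized_det i j k)\<^sup>2 / \<bar>m1 * m2 * m3\<bar> = (normalized_det i j k)\<^sup>2 / normalized_minors i j k"
    using \<beta> by (simp add: power_mult_distrib)
qed

lemma lift_line_neq:
  assumes d: "2 \<le> d" and ij: "steeper i j" shows "lift d (line i) \<noteq> lift d (line j)"
proof -
  have "(\<beta> i * \<alpha> j)\<^sup>2 < (\<beta> j * \<alpha> i)\<^sup>2"
    using ij beta_bounds(1)[of i] by (intro power_strict_mono) (auto simp: steeper_def \<alpha>_def)
  then have "(\<alpha> i)\<^sup>2 * (\<beta> j)\<^sup>2 - (\<alpha> j)\<^sup>2 * (\<beta> i)\<^sup>2 \<noteq> 0"
    by (simp add: power_mult_distrib mult.commute)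
  then show ?thesis unfolding line_def by (rule lift_neq[OF d])
qed

lemma inj_lift_line: "2 \<le> d \<Longrightarrow> inj (\<lambda>i. lift d (line i))"
  using lift_line_neq steeper_total by (metis injI)

lemma inj_line: "inj line"
  by (metis inj_lift_line inj_on_def order_refl)

definition chain :: "nat \<times> nat \<times> nat \<Rightarrow> bool" where
  "chain = (\<lambda>(i, j, k). steeper i j \<and> steeper j k)"

definition facets :: "nat \<Rightarrow> nat \<times> nat \<times> nat \<Rightarrow> (nat \<Rightarrow> real) set set" where
  "facets d = (\<lambda>(i, j, k). arrangement d (line ` {i, j, k}))"

lemma chain_eqI:
  assumes "chain (i, j, k)" "chain (i', j', k')" "{i, j, k} = {i', j', k'}"
  shows "(i, j, k) = (i', j', k')"
proof -
  have c: "steeper i j" "steeper j k" "steeper i k" "steeper i' j'" "steeper j' k'" "steeper i' k'"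
    using assms(1,2) steeper_trans by (auto simp: chain_def)
  have "i = i'" "k = k'"
    using assms(3) c steeper_antisym by (metis insert_iff singletonD)+
  moreover have "j = j'"
    using assms(3) c steeper_antisym \<open>i = i'\<close> \<open>k = k'\<close> by (metis insert_iff singletonD)
  ultimately show ?thesis by simp
qed

lemma chain_simplex:
  assumes d: "2 \<le> d" and c: "chain (i, j, k)" and e: "normalized_det i j k \<noteq> 0"
  obtains g :: "nat \<Rightarrow> (nat \<Rightarrow> real) \<Rightarrow> real" and V where "barycentric d {..d} g V"
    "barycentric.facet d g ` {..d} = facets d (i, j, k)"
    "volume d (barycentric.open_simplex d {..d} g) =
       (normalized_det i j k)\<^sup>2 / normalized_minors i j k * volume d (std_simplex d)"
proof -
  have ij: "steeper i j" and jk: "steeper j k" using c by (auto simp: chain_def)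
  note dets = line_determinants[OF ij jk]
  have \<beta>: "0 < \<beta> j" "0 < \<beta> k" using steeper_ratio(2)[OF ij] steeper_ratio(2)[OF jk] by auto
  interpret planar_triangle d "(\<alpha> i)\<^sup>2" "(\<beta> i)\<^sup>2" "\<kappa> i * \<alpha> i * \<beta> i" "(\<alpha> j)\<^sup>2" "(\<beta> j)\<^sup>2"
    "\<kappa> j * \<alpha> j * \<beta> j" "(\<alpha> k)\<^sup>2" "(\<beta> k)\<^sup>2" "\<kappa> k * \<alpha> k * \<beta> k"
  proof
    show "\<kappa> i * \<alpha> i * \<beta> i * ((\<alpha> j)\<^sup>2 * (\<beta> k)\<^sup>2 - (\<alpha> k)\<^sup>2 * (\<beta> j)\<^sup>2) +
      \<kappa> j * \<alpha> j * \<beta> j * ((\<alpha> k)\<^sup>2 * (\<beta> i)\<^sup>2 - (\<alpha> i)\<^sup>2 * (\<beta> k)\<^sup>2) +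
      \<kappa> k * \<alpha> k * \<beta> k * ((\<alpha> i)\<^sup>2 * (\<beta> j)\<^sup>2 - (\<alpha> j)\<^sup>2 * (\<beta> i)\<^sup>2) \<noteq> 0"
      unfolding dets(4) using \<beta> e by simp
  qed (use d dets(1-3) in auto)
  have vol: "volume d open_simplex = (normalized_det i j k)\<^sup>2 / normalized_minors i j k * volume d (std_simplex d)"
  proof -
    have "(\<alpha> i)\<^sup>2 \<noteq> 0" using steeper_ratio(1)[OF ij] by simp
    from volume_open_simplex[OF this] show ?thesis
      unfolding D_def m1_def m2_def m3_def dets(4) dets(5) .
  qed
  have "facet ` {..d} = facets d (i, j, k)"
    unfolding facets_eq facets_def arrangement_def by (simp add: line_def)
  then show thesis using that[OF barycentric_axioms _ vol] by blast
qed

lemma chain_forms_simplex: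
  assumes d: "2 \<le> d" and c: "chain t" and e: "case t of (i, j, k) \<Rightarrow> normalized_det i j k \<noteq> 0"
  shows "forms_simplex d (facets d t)"
    and "volume d (simplex_of d (facets d t)) = 
      (case t of (i, j, k) \<Rightarrow> (normalized_det i j k)\<^sup>2 / normalized_minors i j k) * volume d (std_simplex d)"
proof -
  obtain i j k where t: "t = (i, j, k)" by (cases t)
  then obtain g V where gV: "barycentric d {..d} g V"
    "barycentric.facet d g ` {..d} = facets d t"
    "volume d (barycentric.open_simplex d {..d} g) =
       (normalized_det i j k)\<^sup>2 / normalized_minors i j k * volume d (std_simplex d)"
    using chain_simplex[OF d, of i j k] c e by auto
  interpret barycentric d "{..d}" g V by (rule gV(1))
  show "forms_simplex d (facets d t)" using forms_simplex_facets gV(2) by simp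
  show "volume d (simplex_of d (facets d t)) = 
      (case t of (i, j, k) \<Rightarrow> (normalized_det i j k)\<^sup>2 / normalized_minors i j k) * volume d (std_simplex d)"
    using simplex_of_facets gV(2,3) by (simp add: t)
qed

text \<open>
  The simplex determines its facet hyperplanes, these determine the set of the three lines, and the order
  by steepness determines the triple.
\<close>

lemma chain_simplex_inj:
  assumes d: "2 \<le> d"
  shows "inj_on (\<lambda>t. simplex_of d (facets d t)) {t. chain t \<and> (case t of (i, j, k) \<Rightarrow> normalized_det i j k \<noteq> 0)}"
proof (rule inj_onI, clarsimp)
  fix i j k i' j' k'
  assume c: "chain (i, j, k)" "normalized_det i j k \<noteq> 0" and c': "chain (i', j', k')" "normalized_det i' j' k' \<noteq> 0"
    and eq: "simplex_of d (facets d (i, j, k)) = simplex_of d (facets d (i', j', k'))"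
  obtain g V where g: "barycentric d {..d} g V" "barycentric.facet d g ` {..d} = facets d (i, j, k)"
    using chain_simplex[OF d c] by metis
  obtain g' V' where g': "barycentric d {..d} g' V'" "barycentric.facet d g' ` {..d} = facets d (i', j', k')"
    using chain_simplex[OF d c'] by metis
  have "barycentric.open_simplex d {..d} g = barycentric.open_simplex d {..d} g'"
    using eq barycentric.simplex_of_facets[OF g(1)] barycentric.simplex_of_facets[OF g'(1)] g(2) g'(2) by simp
  then have "facets d (i, j, k) = facets d (i', j', k')"
    using facets_eq_if_simplex_eq[OF g(1) g'(1)] g(2) g'(2) by simp
  then have "arrangement d (line ` {i, j, k}) = arrangement d (line ` {i', j', k'})"
    by (simp add: facets_def)
  moreover have "inj_on (lift d) (range line)"
    using inj_lift_line[OF d] by (auto simp: inj_on_def)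
  ultimately have "line ` {i, j, k} = line ` {i', j', k'}"
    using arrangement_inj[of d "range line"] by (metis image_mono subset_UNIV)
  then have "{i, j, k} = {i', j', k'}" using inj_line by (metis inj_image_eq_iff)
  then show "i = i' \<and> j = j' \<and> k = k'" using chain_eqI[OF c(1) c'(1)] by simp
qed

lemma card_3_chain:
  assumes "card J = 3" obtains i j k where "J = {i, j, k}" "chain (i, j, k)"
proof -
  obtain p q r where J: "J = {p, q, r}" and d: "p \<noteq> q" "q \<noteq> r" "p \<noteq> r"
    using assms by (auto simp: card_3_iff)
  have *: "\<And>i j k. {i, j, k} = J \<Longrightarrow> steeper i j \<Longrightarrow> steeper j k \<Longrightarrow> thesis"
    using that by (auto simp: chain_def)
  have perms: "{p, q, r} = J" "{p, r, q} = J" "{q, p, r} = J" "{q, r, p} = J" "{r, p, q} = J" "{r, q, p} = J"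
    using J by auto
  show thesis
    using steeper_total[OF d(1)] steeper_total[OF d(2)] steeper_total[OF d(3)]
      *[OF perms(1)] *[OF perms(2)] *[OF perms(3)] *[OF perms(4)] *[OF perms(5)] *[OF perms(6)]
    by blast
qed

section \<open>Counting the simplices of maximum volume\<close>

definition planes :: "nat \<Rightarrow> nat \<Rightarrow> (nat \<Rightarrow> real) set set" where
  "planes d m = arrangement d (line ` {..<m + 2})"

lemma planes_hyperplanes:
  assumes d: "2 \<le> d"
  shows "finite (planes d m)" "card (planes d m) = m + d" "\<forall>P\<in>planes d m. hyperplane d P"
proof -
  show "finite (planes d m)" by (simp add: planes_def arrangement_def)
  have "inj_on (lift d) (line ` {..<m + 2})"
    using inj_lift_line[OF d] by (auto simp: inj_on_def)
  moreover have "card (line ` {..<m + 2}) = m + 2"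
    using card_image[OF inj_on_subset[OF inj_line subset_UNIV], of "{..<m + 2}"] by simp
  ultimately show "card (planes d m) = m + d"
    using d by (simp add: planes_def card_arrangement)
  show "\<forall>P\<in>planes d m. hyperplane d P"
  proof
    fix P assume "P \<in> planes d m"
    then consider i where "P = lift d (line i)" | k where "k < d" "P = coord_plane d k"
      unfolding planes_def arrangement_def by auto
    then show "hyperplane d P"
    proof cases
      case 1
      have "((\<alpha> i)\<^sup>2, (\<beta> i)\<^sup>2) \<noteq> (0, 0)" by (simp add: \<alpha>_def \<beta>_def)
      then show ?thesis unfolding 1 line_def by (rule hyperplane_lift[OF d])
    next
      case 2
      then show ?thesis by (simp add: hyperplane_coord_plane)
    qed
  qed
qed

text \<open>
  The standard simplex is the cone over the triangle between the axes and a far line, so its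
  volume is the maximum that is attained by the pentagons.
\<close>

lemma volume_le:
  assumes d: "2 \<le> d" and S: "S \<subseteq> planes d m" "forms_simplex d S"
  shows "volume d (simplex_of d S) \<le> volume d (std_simplex d)"
proof -
  have inj: "inj_on (lift d) (line ` {..<m + 2})"
    using inj_lift_line[OF d] by (auto simp: inj_on_def)
  obtain T where T: "T \<subseteq> line ` {..<m + 2}" "card T = 3" "S = arrangement d T"
    using simplex_subset_arrangement[OF inj d] S unfolding planes_def by metis
  then obtain J where J: "T = line ` J" by (meson subset_imageE)
  then have "card J = 3"
    using T(2) card_image[OF inj_on_subset[OF inj_line subset_UNIV], of J] by simp
  then obtain i j k where ijk: "J = {i, j, k}" and c: "chain (i, j, k)" by (rule card_3_chain)
  have SF: "S = facets d (i, j, k)" using T(3) J ijk by (simp add: facets_def)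
  have ij: "steeper i j" and jk: "steeper j k" using c by (auto simp: chain_def)
  have e: "normalized_det i j k \<noteq> 0"
  proof
    assume "normalized_det i j k = 0"
    then have "\<not> forms_simplex d (arrangement d {line i, line j, line k})"
      unfolding line_def using line_determinants(3,4)[OF ij jk]
      by (intro concurrent_not_simplex[OF d]) simp_all
    then show False using S(2) SF by (simp add: facets_def)
  qed
  have "volume d (simplex_of d S) = (normalized_det i j k)\<^sup>2 / normalized_minors i j k * volume d (std_simplex d)"
    using chain_forms_simplex(2)[OF d c] e SF by simp
  also have "\<dots> \<le> 1 * volume d (std_simplex d)"
  proof (rule mult_right_mono)
    show "(normalized_det i j k)\<^sup>2 / normalized_minors i j k \<le> 1"
      using normalized_det_sq_le[OF ij jk] normalized_minors_pos[OF ij jk] by simp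
    show "0 \<le> volume d (std_simplex d)" by (simp add: volume_def)
  qed
  finally show ?thesis by simp
qed

text \<open>
  The five triangles of maximum area formed by the axes 0, 1 and the consecutive lines
  \<open>3 b + 2\<close>, \<open>3 b + 3\<close>, \<open>3 b + 4\<close>, of which the middle one is near. The lines of a triangle are listed by
  decreasing steepness.
\<close>

definition pentagon :: "nat \<Rightarrow> (nat \<times> nat \<times> nat) set" where
  "pentagon b = {(0, 3 * b + 2, 1), (0, 3 * b + 4, 1), (3 * b + 3, 3 * b + 2, 1),
     (0, 3 * b + 4, 3 * b + 3), (3 * b + 4, 3 * b + 3, 3 * b + 2)}"

lemma pentagon_chain: "t \<in> pentagon b \<Longrightarrow> chain t"
  by (auto simp: pentagon_def chain_def steeper_iff)

lemma pentagon_maximal: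
  assumes "(i, j, k) \<in> pentagon b"
  shows "(normalized_det i j k)\<^sup>2 = normalized_minors i j k"
proof -
  have "level (3 * b) = 4 * b" "level (3 * b + 1) = 4 * b + 1" "level (3 * b + 2) = 4 * b + 2"
    unfolding level_def by presburger+
  then have \<beta>: "\<beta> (3 * b + 2) = \<zeta> ^ (4 * b)" "\<beta> (3 * b + 3) = \<zeta> ^ (4 * b + 1)" "\<beta> (3 * b + 4) = \<zeta> ^ (4 * b + 2)"
    by (simp_all add: \<beta>_def)
  have nar: "\<not> near 0" "\<not> near 1" "\<not> near (3 * b + 2)" "near (3 * b + 3)" "\<not> near (3 * b + 4)"
    by (simp_all add: near_def) presburger+
  have \<kappa>: "\<kappa> 0 = 1" "\<kappa> 1 = 1" "\<kappa> (3 * b + 2) = 1" "\<kappa> (3 * b + 3) = \<zeta> ^ 3" "\<kappa> (3 * b + 4) = 1"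
    using nar by (simp_all add: \<kappa>_def)
  have r0: "ratio 0 j = 0" "ratio i 1 = 0" for i j
    by (simp_all add: ratio_def \<beta>_def \<alpha>_def)
  have rz: "ratio (3 * b + 3) (3 * b + 2) = \<zeta>" "ratio (3 * b + 4) (3 * b + 3) = \<zeta>"
    unfolding ratio_def \<beta> using zeta_pos by (simp_all add: \<alpha>_def power_add power2_eq_square)
  have z3: "\<zeta> ^ 3 * \<zeta> = 1 - \<zeta>\<^sup>2" using zeta_pow4 by (simp add: power3_eq_cube power4_eq_xxxx)
  have edge: "(1 - \<zeta>\<^sup>2 - 1)\<^sup>2 = 1 - \<zeta>\<^sup>2" using zeta_pow4 by (simp flip: power_mult)
  have mid: "(\<zeta> * (1 - \<zeta>\<^sup>2) - \<zeta> ^ 3 * (1 - \<zeta>\<^sup>2 * \<zeta>\<^sup>2) + \<zeta> * (1 - \<zeta>\<^sup>2))\<^sup>2 = minor_form \<zeta> \<zeta>"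
  proof -
    have a: "1 - \<zeta>\<^sup>2 = \<zeta> ^ 4" using zeta_pow4 by simp
    have b: "1 - \<zeta>\<^sup>2 * \<zeta>\<^sup>2 = \<zeta>\<^sup>2" using zeta_pow4 by (simp flip: power_add)
    show ?thesis unfolding a b by (simp add: power2_eq_square power3_eq_cube power4_eq_xxxx algebra_simps)
  qed
  from assms consider
    "(i, j, k) = (0, 3 * b + 2, 1)" | "(i, j, k) = (0, 3 * b + 4, 1)"
    | "(i, j, k) = (3 * b + 3, 3 * b + 2, 1)" | "(i, j, k) = (0, 3 * b + 4, 3 * b + 3)"
    | "(i, j, k) = (3 * b + 4, 3 * b + 3, 3 * b + 2)"
    unfolding pentagon_def by blast
  then show ?thesis
  proof cases
    case 1
    then have ijk: "i = 0" "j = 3 * b + 2" "k = 1" by simp_all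
    show ?thesis unfolding normalized_det_def normalized_minors_def ijk \<kappa> r0 by simp
  next
    case 2
    then have ijk: "i = 0" "j = 3 * b + 4" "k = 1" by simp_all
    show ?thesis unfolding normalized_det_def normalized_minors_def ijk \<kappa> r0 by simp
  next
    case 3
    then have ijk: "i = 3 * b + 3" "j = 3 * b + 2" "k = 1" by simp_all
    show ?thesis unfolding normalized_det_def normalized_minors_def ijk \<kappa> r0 rz z3 using edge by simp
  next
    case 4
    then have ijk: "i = 0" "j = 3 * b + 4" "k = 3 * b + 3" by simp_all
    show ?thesis unfolding normalized_det_def normalized_minors_def ijk \<kappa> r0 rz using edge z3 by simp
  next
    case 5
    then have ijk: "i = 3 * b + 4" "j = 3 * b + 3" "k = 3 * b + 2" by simp_all
    show ?thesis unfolding normalized_det_def normalized_minors_def ijk \<kappa> rz using mid by simp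
  qed
qed

lemma card_pentagons: "card (\<Union>b<B. pentagon b) = 5 * B"
proof -
  have "card (pentagon b) = 5" for b by (simp add: pentagon_def)
  moreover have "pentagon b \<inter> pentagon b' = {}" if "b \<noteq> b'" for b b'
    using that unfolding pentagon_def by auto
  moreover have "finite (pentagon b)" for b by (simp add: pentagon_def)
  ultimately have "card (\<Union>b<B. pentagon b) = (\<Sum>b<B. 5)"
    by (subst card_UN_disjoint) auto
  then show ?thesis by simp
qed

lemma finite_simplices: "finite H \<Longrightarrow> finite (simplices d H)"
  unfolding simplices_def by (rule finite_subset[of _ "simplex_of d ` Pow H"]) auto

text \<open>This bound makes the set of numbers finite whose maximum is \<open>max_count\<close>.\<close>

lemma card_max_volume_le:
  assumes "finite H" shows "card (max_volume_simplices d H) \<le> 2 ^ card H"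
proof -
  have "max_volume_simplices d H \<subseteq> simplex_of d ` Pow H"
    by (auto simp: max_volume_simplices_def simplices_def)
  then have "card (max_volume_simplices d H) \<le> card (simplex_of d ` Pow H)"
    using assms by (intro card_mono) auto
  also have "\<dots> \<le> card (Pow H)" using assms by (intro card_image_le) auto
  finally show ?thesis using assms by (simp add: card_Pow)
qed

lemma many_max_volume_simplices:
  assumes d: "2 \<le> d"
  shows "5 * (m div 3) \<le> card (max_volume_simplices d (planes d m))"
proof -
  define G where "G = (\<Union>b<m div 3. pentagon b)"
  let ?f = "\<lambda>t. simplex_of d (facets d t)"
  have good: "chain t \<and> (case t of (i, j, k) \<Rightarrow> normalized_det i j k \<noteq> 0 \<and> (normalized_det i j k)\<^sup>2 / normalized_minors i j k = 1)"
    if "t \<in> G" for t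
  proof -
    obtain i j k b where t: "t = (i, j, k)" "(i, j, k) \<in> pentagon b" using \<open>t \<in> G\<close> by (cases t) (auto simp: G_def)
    have c: "chain (i, j, k)" using pentagon_chain t by blast
    then have "0 < normalized_minors i j k" using normalized_minors_pos by (auto simp: chain_def)
    then show ?thesis using pentagon_maximal[OF t(2)] c t(1) by auto
  qed
  have inj: "inj_on ?f G"
    by (rule inj_on_subset[OF chain_simplex_inj[OF d]]) (use good in fastforce)
  have "?f ` G \<subseteq> max_volume_simplices d (planes d m)"
  proof
    fix \<Delta> assume "\<Delta> \<in> ?f ` G"
    then obtain t where t: "t \<in> G" "\<Delta> = ?f t" by blast
    obtain i j k where ijk: "t = (i, j, k)" by (cases t)
    have g: "chain t" "normalized_det i j k \<noteq> 0" "(normalized_det i j k)\<^sup>2 / normalized_minors i j k = 1"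
      using good[OF t(1)] ijk by auto
    have form: "forms_simplex d (facets d t)" and vol: "volume d \<Delta> = volume d (std_simplex d)"
      using chain_forms_simplex[OF d g(1)] g(2,3) t(2) ijk by auto
    obtain b where b: "b < m div 3" "t \<in> pentagon b" using t(1) by (auto simp: G_def)
    have "3 * b + 4 < m + 2" using b(1) by presburger
    then have "{i, j, k} \<subseteq> {..<m + 2}" using b(2) ijk by (auto simp: pentagon_def)
    then have sub: "facets d t \<subseteq> planes d m"
      unfolding facets_def planes_def arrangement_def ijk by auto
    have "\<Delta> \<in> simplices d (planes d m)"
      using form sub t(2) by (auto simp: simplices_def)
    moreover have "volume d \<Delta>' \<le> volume d \<Delta>" if "\<Delta>' \<in> simplices d (planes d m)" for \<Delta>'
      using that volume_le[OF d] vol by (auto simp: simplices_def)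
    ultimately show "\<Delta> \<in> max_volume_simplices d (planes d m)"
      by (simp add: max_volume_simplices_def)
  qed
  moreover have "finite (max_volume_simplices d (planes d m))"
    using finite_simplices[OF planes_hyperplanes(1)[OF d]] by (simp add: max_volume_simplices_def)
  ultimately have "card (?f ` G) \<le> card (max_volume_simplices d (planes d m))"
    by (intro card_mono)
  then show ?thesis using card_image[OF inj] card_pentagons by (simp add: G_def)
qed

lemma max_count_ge:
  assumes "2 \<le> d" shows "5 * (m div 3) \<le> max_count d (m + d)"
proof -
  let ?C = "{card (max_volume_simplices d H) | H. finite H \<and> card H = m + d \<and> (\<forall>P\<in>H. hyperplane d P)}"
  have "?C \<subseteq> {..2 ^ (m + d)}" using card_max_volume_le[of _ d] by fastforce
  then have fin: "finite ?C" by (rule finite_subset) simp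
  have "card (max_volume_simplices d (planes d m)) \<in> ?C"
    using planes_hyperplanes[OF assms] by blast
  then have "card (max_volume_simplices d (planes d m)) \<le> max_count d (m + d)"
    unfolding max_count_def using fin by (rule Max_ge[rotated])
  then show ?thesis using many_max_volume_simplices[OF assms, of m] by simp
qed

theorem theorem1p4:
  "\<exists>C::real. \<forall>d n::nat. 2 \<le> d \<longrightarrow> d + 1 \<le> n \<longrightarrow>
     real (max_count d n) > 7 / 5 * (real n - real d) - C"
proof (intro exI allI impI)
  fix d n :: nat assume d: "2 \<le> d" and n: "d + 1 \<le> n"
  define m where "m = n - d"
  have n_eq: "n = m + d" using n by (simp add: m_def)
  have "m \<le> 3 * (m div 3) + 2" by presburger
  then have "real m \<le> 3 * real (m div 3) + 2" by linarith
  moreover have "5 * real (m div 3) \<le> real (max_count d n)"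
    using of_nat_mono[OF max_count_ge[OF d, of m], where 'a = real] n_eq by simp
  \<comment> \<open>\<open>5 * (m - 2) / 3\<close> exceeds \<open>7 / 5 * m - 4\<close>.\<close>
  ultimately show "real (max_count d n) > 7 / 5 * (real n - real d) - 4"
    unfolding n_eq by simp
qed

end
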